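(* Consider the network with one base station $B$, $n\ge 1$ CUEs, $m\ge 1$ D2D pairs and one eavesdropper $E$ described in the context, with mode selection probability $p\in[0,1]$, spectrum partition factor $\beta\in[0,1]$ and target secrecy rate $r_s>0$. Put $\varepsilon=\frac{p}{n}$ and $\vartheta=p\left(1-\frac1n\right)$. Then for every $i\in\{1,\dots,n\}$ the secrecy outage probability $\mathbf P_{so}^{\,i}=\mathbb P(C_s^{\,i}<r_s)$ of CUE $A_i$ is $$\mathbf P_{so}^{\,i}=1-\sum_{\mathbf D_u\in 2^{\mathcal D}}\varepsilon^{|\mathbf D_u|}\left[\vartheta^{m-|\mathbf D_u|}\Theta_i(\mathbf D_u,1)+\left((1-\varepsilon)^{m-|\mathbf D_u|}-\vartheta^{m-|\mathbf D_u|}\right)\Theta_i(\mathbf D_u,\beta)\right],$$ where $$\Theta_i(\emptyset,\beta)=\frac{\exp\left(-\frac{2^{nr_s/\beta}-1}{\gamma_{A_i,B}}\right)}{\frac{\gamma_{A_i,E}}{\gamma_{A_i,B}}2^{nr_s/\beta}+1},$$ and for $\mathbf D_u\ne\emptyset$ $$\Theta_i(\mathbf D_u,\beta)=\int_0^\infty\!\!\int_0^\infty \frac{\exp\left(-\frac{(2^{nr_s/\beta}-1)(x+1)}{\gamma_{A_i,B}}\right)}{\frac{\gamma_{A_i,E}}{\gamma_{A_i,B}}\frac{x+1}{y+1}2^{nr_s/\beta}+1}\,\mathbf f_{\mathbf D_u}(x)\,\mathbf g_{\mathbf D_u}(y)\,\mathrm dx\,\mathrm dy .$$ Moreover the average secrecy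 capacity $\mathbf C_s^{\,i}=\mathbb E[C_s^{\,i}]$ of CUE $A_i$ is $$\mathbf C_s^{\,i}=\frac{1}{n\ln 2}\sum_{\mathbf D_u\in 2^{\mathcal D}}\varepsilon^{|\mathbf D_u|}\Lambda_i(\mathbf D_u)\left(\beta(1-\varepsilon)^{m-|\mathbf D_u|}+(1-\beta)\vartheta^{m-|\mathbf D_u|}\right),$$ where $$\Lambda_i(\emptyset)=\Psi\left(\frac1{\gamma_{A_i,B}}+\frac1{\gamma_{A_i,E}}\right)-\Psi\left(\frac1{\gamma_{A_i,B}}\right),$$ and for $\mathbf D_u\neq\emptyset$ $$\Lambda_i(\mathbf D_u)=\int_0^\infty\!\!\int_0^\infty\left[\Psi\left(\frac{x+1}{\gamma_{A_i,B}}+\frac{y+1}{\gamma_{A_i,E}}\right)-\Psi\left(\frac{x+1}{\gamma_{A_i,B}}\right)\right]\mathbf f_{\mathbf D_u}(x)\,\mathbf g_{\mathbf D_u}(y)\,\mathrm dx\,\mathrm dy .$$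
   Context: Network: a base station $B$, an eavesdropper $E$, cellular users (CUEs) $A_1,\dots,A_n$, and a set $\mathcal D=\{D_1,\dots,D_m\}$ of D2D pairs, $D_j$ having transmitter $D_j^t$ and receiver $D_j^r$. For a transmitting node $a$ and a receiving node $b$, $\mathrm{SNR}_{a,b}$ is an exponentially distributed random variable with mean $\gamma_{a,b}>0$; all these random variables (for different pairs $(a,b)$) are mutually independent. Mode selection: independently of each other and of the SNRs, each D2D pair is in underlay mode with probability $p$ and in overlay mode with probability $1-p$; each underlay pair reuses the spectrum of exactly one CUE, chosen independently and uniformly among the $n$ CUEs. $\mathcal D_o$ is the random set of overlay pairs and $\mathcal D_u^i$ the random set of underlay pairs reusing the spectrum of $A_i$. Spectrum partition (total bandwidth $1$): a fraction $\tilde\beta$ of the spectrum is shared equally among the $n$ CUEs, where $\tilde\beta=\beta$ if $\mathcal D_o\neq\emptyset$ and $\tilde\beta=1$ if $\mathcal D_o=\emptyset$. Secrecy capacity of $A_i$: for $b\in\{B,E\}$ let $$\mathrm{SINR}_{A_i,b}=\frac{\mathrm{SNR}_{A_i,b}}{\sum_{D_k\in\mathcal D_u^i}\mathrm{SNR}_{D_k^t,b}+1},\qquad C_s^{\,i}=\frac{\tilde\beta}{n}\left[\log_2\frac{1+\mathrm{SINR}_{A_i,B}}{1+\mathrm{SINR}_{A_i,E}}\right]^+,\qquad [x]^+=\max\{x,0\}.$$ Notation: $2^{\mathcal D}$ is the power set of $\mathcal D$. For nonempty $\mathbf D_u\subseteq\mathcal D$, $\mathbf f_{\mathbf D_u}$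 and $\mathbf g_{\mathbf D_u}$ are the probability density functions of $\sum_{D_k\in\mathbf D_u}\mathrm{SNR}_{D_k^t,B}$ and $\sum_{D_k\in\mathbf D_u}\mathrm{SNR}_{D_k^t,E}$ respectively (convolutions of exponential densities). $\Psi(x)=e^x\mathrm{Ei}(-x)$ for $x>0$, where $\mathrm{Ei}(-x)=-\int_x^\infty\frac{e^{-t}}{t}\,\mathrm dt$. Conventions: $0^0=1$; for $\beta=0$, $\Theta_i(\mathbf D_u,0)$ is read as its limiting value $0$. *)

theory Defs
  imports "HOL-Probability.Probability"
begin

datatype transmitter = CUE nat | D2D_tx nat
datatype receiver = BS | Eve | D2D_rx nat

definition links :: "nat \<Rightarrow> nat \<Rightarrow> (transmitter \<times> receiver) set" where
  "links n m = (CUE ` {1..n} \<union> D2D_tx ` {1..m}) \<times> ({BS, Eve} \<union> D2D_rx ` {1..m})"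

(* None stands for overlay mode, Some i for underlay mode reusing the spectrum of CUE i. *)
definition allocation_pmf :: "real \<Rightarrow> nat \<Rightarrow> nat option pmf" where
  "allocation_pmf p n =
     bind_pmf (bernoulli_pmf p)
       (\<lambda>underlay. if underlay then map_pmf Some (pmf_of_set {1..n}) else return_pmf None)"

(* The SNRs and the allocations take values in different types, so their joint mutual
   independence is stated for the generated sigma-algebras instead of with indep_vars. *)
locale d2d_network = prob_space M for M :: "'a measure" +
  fixes n m :: nat
    and p :: real
    and \<gamma> :: "transmitter \<Rightarrow> receiver \<Rightarrow> real"
    and SNR :: "transmitter \<Rightarrow> receiver \<Rightarrow> 'a \<Rightarrow> real"
    and alloc :: "nat \<Rightarrow> 'a \<Rightarrow> nat option"
  assumes mean_pos: "\<And>a b. (a, b) \<in> links n m \<Longrightarrow> \<gamma> a b > 0"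
    and SNR_exponential: "\<And>a b. (a, b) \<in> links n m \<Longrightarrow>
          distributed M lborel (SNR a b) (exponential_density (1 / \<gamma> a b))"
    and alloc_measurable: "\<And>j. j \<in> {1..m} \<Longrightarrow> random_variable (count_space UNIV) (alloc j)"
    and alloc_distr: "\<And>j. j \<in> {1..m} \<Longrightarrow>
          distr M (count_space UNIV) (alloc j) = measure_pmf (allocation_pmf p n)"
    and mutually_independent:
      "indep_sets
         (case_sum
            (\<lambda>(a, b). {SNR a b -` S \<inter> space M | S. S \<in> sets borel})
            (\<lambda>j. {alloc j -` S \<inter> space M | S. S \<in> sets (count_space UNIV)}))
         (links n m <+> {1..m})"

definition overlay_pairs :: "nat \<Rightarrow> (nat \<Rightarrow> 'a \<Rightarrow> nat option) \<Rightarrow> 'a \<Rightarrow> nat set" where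
  "overlay_pairs m alloc \<omega> = {j \<in> {1..m}. alloc j \<omega> = None}"

definition underlay_pairs :: "nat \<Rightarrow> (nat \<Rightarrow> 'a \<Rightarrow> nat option) \<Rightarrow> nat \<Rightarrow> 'a \<Rightarrow> nat set" where
  "underlay_pairs m alloc i \<omega> = {j \<in> {1..m}. alloc j \<omega> = Some i}"

definition interference ::
  "(transmitter \<Rightarrow> receiver \<Rightarrow> 'a \<Rightarrow> real) \<Rightarrow> nat set \<Rightarrow> receiver \<Rightarrow> 'a \<Rightarrow> real" where
  "interference SNR D b \<omega> = (\<Sum>k\<in>D. SNR (D2D_tx k) b \<omega>)"

definition SINR ::
  "nat \<Rightarrow> (transmitter \<Rightarrow> receiver \<Rightarrow> 'a \<Rightarrow> real) \<Rightarrow> (nat \<Rightarrow> 'a \<Rightarrow> nat option) \<Rightarrow>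
   nat \<Rightarrow> receiver \<Rightarrow> 'a \<Rightarrow> real" where
  "SINR m SNR alloc i b \<omega> =
     SNR (CUE i) b \<omega> / (interference SNR (underlay_pairs m alloc i \<omega>) b \<omega> + 1)"

definition cellular_fraction :: "nat \<Rightarrow> real \<Rightarrow> (nat \<Rightarrow> 'a \<Rightarrow> nat option) \<Rightarrow> 'a \<Rightarrow> real" where
  "cellular_fraction m \<beta> alloc \<omega> = (if overlay_pairs m alloc \<omega> \<noteq> {} then \<beta> else 1)"

definition secrecy_capacity ::
  "nat \<Rightarrow> nat \<Rightarrow> real \<Rightarrow> (transmitter \<Rightarrow> receiver \<Rightarrow> 'a \<Rightarrow> real) \<Rightarrow>
   (nat \<Rightarrow> 'a \<Rightarrow> nat option) \<Rightarrow> nat \<Rightarrow> 'a \<Rightarrow> real" where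
  "secrecy_capacity n m \<beta> SNR alloc i \<omega> =
     cellular_fraction m \<beta> alloc \<omega> / real n *
     max (log 2 ((1 + SINR m SNR alloc i BS \<omega>) / (1 + SINR m SNR alloc i Eve \<omega>))) 0"

(* The density of X with respect to Lebesgue measure, as a Radon-Nikodym derivative;
   it is determined up to null sets. *)
definition prob_density :: "'a measure \<Rightarrow> ('a \<Rightarrow> real) \<Rightarrow> real \<Rightarrow> real" where
  "prob_density M X x = enn2real (RN_deriv lborel (distr M lborel X) x)"

(* Meaningful for negative arguments only. *)
definition Ei :: "real \<Rightarrow> real" where
  "Ei z = - (LBINT t:{-z..}. exp (-t) / t)"

definition Psi :: "real \<Rightarrow> real" where
  "Psi x = exp x * Ei (-x)"

(* The value at \<beta> = 0 is the limit for \<beta> tending to 0 from above. *)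
definition Theta ::
  "'a measure \<Rightarrow> nat \<Rightarrow> (transmitter \<Rightarrow> receiver \<Rightarrow> real) \<Rightarrow>
   (transmitter \<Rightarrow> receiver \<Rightarrow> 'a \<Rightarrow> real) \<Rightarrow> real \<Rightarrow> nat \<Rightarrow> nat set \<Rightarrow> real \<Rightarrow> real" where
  "Theta M n \<gamma> SNR r\<^sub>s i D \<beta> =
     (if \<beta> = 0 then 0
      else
        let K = 2 powr (real n * r\<^sub>s / \<beta>);
            \<gamma>\<^sub>B = \<gamma> (CUE i) BS;
            \<gamma>\<^sub>E = \<gamma> (CUE i) Eve;
            f = prob_density M (interference SNR D BS);
            g = prob_density M (interference SNR D Eve)
        in if D = {} then exp (- ((K - 1) / \<gamma>\<^sub>B)) / (\<gamma>\<^sub>E / \<gamma>\<^sub>B * K + 1)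
           else (LBINT y:{0..}. (LBINT x:{0..}.
                   exp (- ((K - 1) * (x + 1) / \<gamma>\<^sub>B))
                     / (\<gamma>\<^sub>E / \<gamma>\<^sub>B * ((x + 1) / (y + 1)) * K + 1) * f x * g y)))"

definition Lambda ::
  "'a measure \<Rightarrow> (transmitter \<Rightarrow> receiver \<Rightarrow> real) \<Rightarrow>
   (transmitter \<Rightarrow> receiver \<Rightarrow> 'a \<Rightarrow> real) \<Rightarrow> nat \<Rightarrow> nat set \<Rightarrow> real" where
  "Lambda M \<gamma> SNR i D =
     (let \<gamma>\<^sub>B = \<gamma> (CUE i) BS;
          \<gamma>\<^sub>E = \<gamma> (CUE i) Eve;
          f = prob_density M (interference SNR D BS);
          g = prob_density M (interference SNR D Eve)
      in if D = {} then Psi (1 / \<gamma>\<^sub>B + 1 / \<gamma>\<^sub>E) - Psi (1 / \<gamma>\<^sub>B)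
         else (LBINT y:{0..}. (LBINT x:{0..}.
                 (Psi ((x + 1) / \<gamma>\<^sub>B + (y + 1) / \<gamma>\<^sub>E) - Psi ((x + 1) / \<gamma>\<^sub>B)) * f x * g y)))"

end

theory Submission
  imports Defs
begin

text \<open>
  Fix the set \<open>D\<close> of pairs sharing the spectrum of \<open>A\<^sub>i\<close>, whether or not some pair is in overlay
  mode, and the two interferences \<open>u\<close> and \<open>v\<close>. With \<open>X\<close> and \<open>Y\<close> the SNRs of \<open>A\<^sub>i\<close> at the base
  station and at the eavesdropper, the event
  \<open>(1 + X / (u + 1)) / (1 + Y / (v + 1)) \<ge> K\<close> reads \<open>X \<ge> a + b Y\<close>, and its probability is the
  elementary integral \<open>exp (- a / \<gamma>\<^sub>B) / (b \<gamma>\<^sub>E / \<gamma>\<^sub>B + 1)\<close>. Integrating it against \<open>dK / K\<close> over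
  \<open>K \<ge> 1\<close> gives the mean of the positive part of the logarithm of the ratio, and a partial fraction
  decomposition turns this integral into a difference of two values of \<open>\<Psi>\<close>. Since allocations,
  signals and interferences are independent, averaging over \<open>u\<close> and \<open>v\<close> gives \<open>\<Theta>\<^sub>i\<close> and \<open>\<Lambda>\<^sub>i\<close>, and
  the allocation contributes the weight \<open>\<epsilon>^|D| \<theta>^(m - |D|)\<close> if no pair is in overlay mode, out of
  the total weight \<open>\<epsilon>^|D| (1 - \<epsilon>)^(m - |D|)\<close> of \<open>D\<close>.
\<close>

section \<open>Exponential integrals\<close>

lemma emeasure_exponential_density_atLeast:
  assumes "0 < l" "0 \<le> t"
  shows "emeasure (density lborel (exponential_density l)) {t..} = ennreal (exp (- (t * l)))"
proof -
  have "emeasure (density lborel (exponential_density l)) {t..} =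
      (\<integral>\<^sup>+x. ennreal (l * exp (- (x * l))) * indicator {t..} x \<partial>lborel)"
    using assms
    by (subst emeasure_density)
       (auto intro!: nn_integral_cong simp: exponential_density_def split: split_indicator)
  also have "\<dots> = 0 - (- exp (- (t * l)))"
  proof (rule nn_integral_FTC_atLeast)
    show "DERIV (\<lambda>x. - exp (- (x * l))) x :> l * exp (- (x * l))" for x
      by (auto intro!: derivative_eq_intros)
    have "filterlim (\<lambda>x. x * l) at_top at_top"
      using assms by (intro filterlim_at_top_mult_tendsto_pos[OF tendsto_const] filterlim_ident) auto
    then have "((\<lambda>x. - exp (- (x * l))) \<longlongrightarrow> - 0) at_top"
      by (intro tendsto_minus filterlim_compose[OF exp_at_bot] filterlim_compose[OF filterlim_uminus_at_bot_at_top])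
    then show "((\<lambda>x. - exp (- (x * l))) \<longlongrightarrow> 0) at_top" by simp
  qed (use assms in auto)
  finally show ?thesis by simp
qed

text \<open>The half-line is the section over \<open>y\<close> of the half-plane where
  \<open>a + b * y\<close> is at most the second coordinate, so its mass depends measurably on
  \<open>y\<close> by the section theorem for a sigma-finite measure.\<close>

lemma measurable_emeasure_exponential_atLeast:
  assumes "0 < l"
  shows "(\<lambda>y. emeasure (density lborel (exponential_density l)) {a + b * y..}) \<in> borel_measurable borel"
proof -
  let ?D = "density lborel (exponential_density l)"
  interpret L: prob_space ?D
    using assms by (rule prob_space_exponential_density)
  have "(\<lambda>y. emeasure ?D (Pair y -` {z \<in> space (borel \<Otimes>\<^sub>M ?D). a + b * fst z \<le> snd z})) \<in> borel_measurable borel"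
    by (rule L.measurable_emeasure_Pair) measurable
  then show ?thesis
    by (simp add: space_pair_measure vimage_def atLeast_def)
qed

text \<open>The tail \<open>exp (- ((a + b * y) * l))\<close> tilts the density of rate
  \<open>r\<close> into the density of rate \<open>b * l + r\<close>, up to the factor
  \<open>exp (- (a * l)) * r / (b * l + r)\<close>; what remains integrates to 1.\<close>

lemma exponential_race:
  assumes "0 < l" "0 < r" "0 \<le> a" "0 \<le> b"
  shows "(\<integral>\<^sup>+y. emeasure (density lborel (exponential_density l)) {a + b * y..}
            \<partial>density lborel (exponential_density r)) = ennreal (exp (- (a * l)) / (b * l / r + 1))"
proof -
  let ?s = "b * l + r"
  have s: "0 < ?s" using assms by (simp add: add_nonneg_pos)
  interpret S: prob_space "density lborel (exponential_density ?s)"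
    using s by (rule prob_space_exponential_density)
  have S1: "(\<integral>\<^sup>+y. ennreal (exponential_density ?s y) \<partial>lborel) = 1"
    using S.emeasure_space_1 by (simp add: emeasure_density)
  have "(\<integral>\<^sup>+y. emeasure (density lborel (exponential_density l)) {a + b * y..}
            \<partial>density lborel (exponential_density r))
      = (\<integral>\<^sup>+y. ennreal (exponential_density r y) * emeasure (density lborel (exponential_density l)) {a + b * y..}
            \<partial>lborel)"
  proof (subst nn_integral_density)
    show "(\<lambda>y. emeasure (density lborel (exponential_density l)) {a + b * y..}) \<in> borel_measurable lborel"
      using measurable_emeasure_exponential_atLeast[OF assms(1)] by simp
  qed auto
  also have "\<dots> = (\<integral>\<^sup>+y. ennreal (exp (- (a * l)) * r / ?s) * ennreal (exponential_density ?s y) \<partial>lborel)"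
  proof (intro nn_integral_cong)
    fix y :: real
    show "ennreal (exponential_density r y) * emeasure (density lborel (exponential_density l)) {a + b * y..}
        = ennreal (exp (- (a * l)) * r / ?s) * ennreal (exponential_density ?s y)"
    proof (cases "y < 0")
      case False
      have "r * exp (- (y * r)) * exp (- ((a + b * y) * l)) = exp (- (a * l)) * r / ?s * (?s * exp (- (y * ?s)))"
      proof -
        have "- (y * r) + - ((a + b * y) * l) = - (a * l) + - (y * ?s)" by (simp add: algebra_simps)
        then have "exp (- (y * r)) * exp (- ((a + b * y) * l)) = exp (- (a * l)) * exp (- (y * ?s))"
          by (simp only: mult_exp_exp)
        then show ?thesis using s by (simp add: mult.assoc)
      qed
      moreover have "0 \<le> a + b * y" using False assms by simp
      ultimately show ?thesis
        using assms s False
        by (subst emeasure_exponential_density_atLeast)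
           (auto simp: exponential_density_def ennreal_mult[symmetric])
    qed (simp add: exponential_density_def)
  qed
  also have "\<dots> = ennreal (exp (- (a * l)) * r / ?s)"
    by (subst nn_integral_cmult) (auto simp: S1)
  also have "exp (- (a * l)) * r / ?s = exp (- (a * l)) / (b * l / r + 1)"
    using assms s by (simp add: field_simps)
  finally show ?thesis .
qed

text \<open>Layer-cake form of the positive part of the logarithm. Once \<open>R\<close> is random,
  it reduces the mean to tail events at levels \<open>K \<ge> 1\<close>, weighted by
  \<open>1 / K\<close>.\<close>

lemma nn_integral_ln_layers:
  assumes "0 < R"
  shows "(\<integral>\<^sup>+K. ennreal (1 / K) * indicator {1..} K * indicator {K..} R \<partial>lborel) = ennreal (max (ln R) 0)"
proof (cases "R \<ge> 1")
  case True
  have "(\<integral>\<^sup>+K. ennreal (1 / K) * indicator {1..} K * indicator {K..} R \<partial>lborel)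
     = (\<integral>\<^sup>+K. ennreal (1 / K) * indicator {1..R} K \<partial>lborel)"
    by (intro nn_integral_cong) (auto split: split_indicator)
  also have "\<dots> = ennreal (ln R - ln 1)"
    by (rule nn_integral_FTC_Icc) (use True in \<open>auto intro!: derivative_eq_intros\<close>)
  finally show ?thesis using True by simp
next
  case False
  then have "(\<integral>\<^sup>+K. ennreal (1 / K) * indicator {1..} K * indicator {K..} R \<partial>lborel) = (\<integral>\<^sup>+K. 0 \<partial>(lborel::real measure))"
    by (intro nn_integral_cong) (auto split: split_indicator)
  then show ?thesis using False assms by (simp add: max_def)
qed

lemma nn_integral_exp_atLeast:
  assumes "0 < (a::real)"
  shows "(\<integral>\<^sup>+t. ennreal (exp (- (a * t))) * indicator {x..} t \<partial>lborel) = ennreal (exp (- (a * x)) / a)"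
proof -
  have "(\<integral>\<^sup>+t. ennreal (exp (- (a * t))) * indicator {x..} t \<partial>lborel) = 0 - (- (exp (- (a * x)) / a))"
  proof (rule nn_integral_FTC_atLeast)
    show "DERIV (\<lambda>t. - (exp (- (a * t)) / a)) t :> exp (- (a * t))" for t
      using assms by (auto intro!: derivative_eq_intros)
    have "filterlim (\<lambda>x. a * x) at_top at_top"
      using assms by (intro filterlim_tendsto_pos_mult_at_top[OF tendsto_const] filterlim_ident) auto
    then have "((\<lambda>x. - (exp (- (a * x)) / a)) \<longlongrightarrow> - (0 / a)) at_top"
      using assms
      by (intro tendsto_intros filterlim_compose[OF exp_at_bot] filterlim_compose[OF filterlim_uminus_at_bot_at_top]) auto
    then show "((\<lambda>t. - (exp (- (a * t)) / a)) \<longlongrightarrow> 0) at_top" by simp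
  qed auto
  then show ?thesis by simp
qed

text \<open>The factor \<open>exp x\<close> is absorbed into the exponential integral, whose
  integrand is positive; estimating \<open>1 / t\<close> by \<open>1 / x\<close> on the range gives
  both finiteness and the bound.\<close>

lemma Psi_nn_integral:
  assumes "0 < x"
  shows "Psi x \<le> 0"
    and "(\<integral>\<^sup>+t. ennreal (exp (x - t) / t) * indicator {x..} t \<partial>lborel) = ennreal (- Psi x)"
    and "- Psi x \<le> 1 / x"
proof -
  let ?I = "\<integral>\<^sup>+t. ennreal (exp (x - t) / t) * indicator {x..} t \<partial>lborel"
  have "?I \<le> (\<integral>\<^sup>+t. ennreal (exp x / x) * (ennreal (exp (- (1 * t))) * indicator {x..} t) \<partial>lborel)"
    using assms
    by (intro nn_integral_mono)
       (auto simp: ennreal_mult[symmetric] exp_diff exp_minus field_simps intro!: ennreal_leI split: split_indicator)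
  also have "\<dots> = ennreal (exp x / x) * ennreal (exp (- x))"
    by (subst nn_integral_cmult) (use nn_integral_exp_atLeast[of 1 x] in simp_all)
  also have "\<dots> = ennreal (1 / x)"
    using assms by (simp add: ennreal_mult[symmetric] exp_minus)
  finally have le: "?I \<le> ennreal (1 / x)" .
  have eq: "?I = (\<integral>\<^sup>+t. ennreal (indicator {x..} t * (exp (x - t) / t)) \<partial>lborel)"
    by (intro nn_integral_cong) (auto split: split_indicator)
  have nonneg: "AE t in lborel. 0 \<le> indicator {x..} t * (exp (x - t) / t)"
    using assms by (auto split: split_indicator)
  \<comment> \<open>\<open>Ei\<close> is a Bochner integral, which is 0 by default for a
    non-integrable function; the finite upper bound rules this case out.\<close>
  have int: "integrable lborel (\<lambda>t. indicator {x..} t * (exp (x - t) / t))"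
    by (rule integrableI_nonneg) (use nonneg le eq in \<open>auto simp: top.not_eq_extremum intro: le_less_trans\<close>)
  have "- Psi x = exp x * (LBINT t:{x..}. exp (- t) / t)"
    by (simp add: Psi_def Ei_def)
  also have "\<dots> = (LBINT t:{x..}. exp (x - t) / t)"
    by (subst set_integral_mult_right[symmetric]) (simp add: exp_diff exp_minus divide_simps)
  finally have P: "- Psi x = (\<integral>t. indicator {x..} t * (exp (x - t) / t) \<partial>lborel)"
    by (simp add: set_lebesgue_integral_def)
  show "Psi x \<le> 0"
    using integral_nonneg_AE[OF nonneg] P by simp
  show I: "?I = ennreal (- Psi x)"
    unfolding eq P by (rule nn_integral_eq_integral[OF int nonneg])
  show "- Psi x \<le> 1 / x"
    using le I assms \<open>Psi x \<le> 0\<close> by (simp)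
qed

text \<open>Substitute \<open>t = a * (K + s)\<close> in the integral for
  \<open>- Psi (a + a * s)\<close>: the range becomes \<open>K \<ge> 1\<close>, and the exponent
  \<open>a + a * s - t\<close> becomes \<open>- ((K - 1) * a)\<close>. The condition
  \<open>0 < 1 + s\<close> keeps the pole at \<open>- s\<close> to the left of the range.\<close>

lemma Psi_nn_integral_scaled:
  assumes a: "0 < a" and s: "0 < 1 + s"
  shows "(\<integral>\<^sup>+K. ennreal (exp (- ((K - 1) * a)) / (K + s)) * indicator {1..} K \<partial>lborel) = ennreal (- Psi (a + a * s))"
proof -
  have x: "0 < a + a * s"
    using mult_pos_pos[OF a s] by (simp add: algebra_simps)
  let ?x = "a + a * s"
  have "ennreal (- Psi ?x) = (\<integral>\<^sup>+t. ennreal (exp (?x - t) / t) * indicator {?x..} t \<partial>lborel)"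
    using Psi_nn_integral(2)[OF x] by simp
  also have "\<dots> = ennreal \<bar>a\<bar> * (\<integral>\<^sup>+K. ennreal (exp (?x - (a * s + a * K)) / (a * s + a * K)) * indicator {?x..} (a * s + a * K) \<partial>lborel)"
    using a by (intro nn_integral_real_affine) auto
  also have "\<dots> = (\<integral>\<^sup>+K. ennreal \<bar>a\<bar> * (ennreal (exp (?x - (a * s + a * K)) / (a * s + a * K)) * indicator {?x..} (a * s + a * K)) \<partial>lborel)"
    by (rule nn_integral_cmult[symmetric]) measurable
  also have "\<dots> = (\<integral>\<^sup>+K. ennreal (exp (- ((K - 1) * a)) / (K + s)) * indicator {1..} K \<partial>lborel)"
  proof (intro nn_integral_cong)
    fix K :: real
    show "ennreal \<bar>a\<bar> * (ennreal (exp (?x - (a * s + a * K)) / (a * s + a * K)) * indicator {?x..} (a * s + a * K)) =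
        ennreal (exp (- ((K - 1) * a)) / (K + s)) * indicator {1..} K"
    proof (cases "1 \<le> K")
      case True
      then have p: "0 < K + s" using s by simp
      have "a * s + a * K = a * (K + s)" "a + a * s - a * (K + s) = - ((K - 1) * a)"
        by (simp_all add: algebra_simps)
      moreover have "a * (exp (- ((K - 1) * a)) / (a * (K + s))) = exp (- ((K - 1) * a)) / (K + s)"
        using a by simp
      moreover have "a + a * s \<le> a * (K + s)"
        using True a by (simp add: distrib_left)
      ultimately show ?thesis
        using True a p by (simp add: ennreal_mult[symmetric] del: times_divide_eq_right)
    next
      case False
      with a show ?thesis by (simp add: indicator_def)
    qed
  qed
  finally show ?thesis by simp
qed

text \<open>Removing the scaled integral with \<open>s = c / a\<close> from that with
  \<open>s = 0\<close> leaves a nonnegative integrand, hence the sign; the upper bound is that of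
  \<open>- Psi a\<close>, as \<open>Psi (a + c)\<close> is not positive.\<close>

lemma Psi_diff:
  assumes a: "0 < a" and c: "0 < c"
  shows "(\<integral>\<^sup>+K. ennreal (1 / K) * indicator {1..} K * ennreal (exp (- ((K - 1) * a)) / (a / c * K + 1)) \<partial>lborel)
           = ennreal (Psi (a + c) - Psi a)" (is "?I = _")
    and "0 \<le> Psi (a + c) - Psi a"
    and "Psi (a + c) - Psi a \<le> 1 / a"
proof -
  let ?f = "\<lambda>K. ennreal (exp (- ((K - 1) * a)) / (K + 0)) * indicator {1..} K"
  let ?g = "\<lambda>K. ennreal (exp (- ((K - 1) * a)) / (K + c / a)) * indicator {1..} K"
  let ?h = "\<lambda>K. ennreal (1 / K) * indicator {1..} K * ennreal (exp (- ((K - 1) * a)) / (a / c * K + 1))"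
  have f: "(\<integral>\<^sup>+K. ?f K \<partial>lborel) = ennreal (- Psi a)"
    using Psi_nn_integral_scaled[of a 0] a by simp
  have g: "(\<integral>\<^sup>+K. ?g K \<partial>lborel) = ennreal (- Psi (a + c))"
    using Psi_nn_integral_scaled[of a "c / a"] a c by (simp add: add_pos_pos)
  \<comment> \<open>The decomposition is integrated as a sum, since subtraction of extended
    nonnegative reals truncates at 0; the finite term \<open>- Psi (a + c)\<close> is cancelled only
    after integration.\<close>
  have "ennreal (- Psi a) = (\<integral>\<^sup>+K. ?h K + ?g K \<partial>lborel)"
  proof (subst f[symmetric], intro nn_integral_cong)
    fix K :: real
    show "?f K = ?h K + ?g K"
    proof (cases "1 \<le> K")
      case True
      then have "0 < K" by simp
      have "1 / K * (exp (- ((K - 1) * a)) / (a / c * K + 1)) + exp (- ((K - 1) * a)) / (K + c / a)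
         = exp (- ((K - 1) * a)) * (1 / (K * (a / c * K + 1)) + 1 / (K + c / a))"
        by (simp add: algebra_simps)
      \<comment> \<open>partial fractions: both \<open>1 / K\<close> and \<open>1 / (K + c / a)\<close> lead to a scaled \<open>Psi\<close> integral\<close>
      also have "1 / (K * (a / c * K + 1)) + 1 / (K + c / a) = 1 / K"
      proof -
        have 1: "0 < a * K + c" using a c \<open>0 < K\<close> by (simp add: add_pos_pos)
        have "a / c * K + 1 = (a * K + c) / c" using c by (simp add: field_simps)
        moreover have "K + c / a = (a * K + c) / a" using a by (simp add: field_simps)
        ultimately have "1 / (K * (a / c * K + 1)) + 1 / (K + c / a) = c / (K * (a * K + c)) + a * K / (K * (a * K + c))"
          using \<open>0 < K\<close> by simp
        also have "\<dots> = (a * K + c) / (K * (a * K + c))" by (simp add: add_divide_distrib)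
        also have "\<dots> = 1 / K" using 1 by simp
        finally show ?thesis .
      qed
      finally have "1 / K * (exp (- ((K - 1) * a)) / (a / c * K + 1)) + exp (- ((K - 1) * a)) / (K + c / a)
         = exp (- ((K - 1) * a)) / (K + 0)" by simp
      with True a c show ?thesis
        by (simp add: ennreal_plus[symmetric] ennreal_mult[symmetric] del: ennreal_plus)
    qed simp
  qed
  also have "\<dots> = ?I + ennreal (- Psi (a + c))"
    by (subst nn_integral_add) (auto simp: g)
  finally have eq: "ennreal (- Psi a) = ?I + ennreal (- Psi (a + c))" .
  have neg: "Psi a \<le> 0" "Psi (a + c) \<le> 0"
    using Psi_nn_integral(1) a c by (auto simp: add_pos_pos)
  have "ennreal (- Psi (a + c)) \<le> ennreal (- Psi a)"
    unfolding eq by simp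
  then show le: "0 \<le> Psi (a + c) - Psi a"
    using neg by simp
  have "?I = ennreal (- Psi a) - ennreal (- Psi (a + c))"
    unfolding eq by simp
  then show "?I = ennreal (Psi (a + c) - Psi a)"
    using neg by (simp add: ennreal_minus)
  show "Psi (a + c) - Psi a \<le> 1 / a"
    using Psi_nn_integral(3)[OF a] neg by simp
qed

lemma borel_measurable_Psi [measurable]: "Psi \<in> borel_measurable borel"
proof -
  \<comment> \<open>Written as a conditional, the indicator is visibly measurable jointly in
    \<open>z\<close> and \<open>t\<close>, so the integral with moving lower limit is a measurable
    parameter integral.\<close>
  have "(\<lambda>z::real. \<integral>t. (if - z \<le> t then 1 else 0 :: real) *\<^sub>R (exp (- t) / t) \<partial>lborel) \<in> borel_measurable borel"
    by measurable
  then have "(\<lambda>z::real. LBINT t:{-z..}. exp (- t) / t) \<in> borel_measurable borel"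
    by (simp add: set_lebesgue_integral_def indicator_def)
  then show ?thesis unfolding Psi_def Ei_def by measurable
qed

section \<open>Secrecy of a single link at fixed interference\<close>

text \<open>For \<open>K \<ge> 1\<close>, the probability that \<open>sinr_ratio\<close> is at least
  \<open>K\<close> when the interferences at the base station and at the eavesdropper are frozen at
  \<open>u\<close> and \<open>v\<close> and the signals are independent exponentials with means
  \<open>\<gamma>\<^sub>B\<close> and \<open>\<gamma>\<^sub>E\<close>. It is the kernel of
  \<open>Theta\<close>.\<close>

definition secrecy_tail :: "real \<Rightarrow> real \<Rightarrow> real \<Rightarrow> real \<Rightarrow> real \<Rightarrow> real" where
  "secrecy_tail \<gamma>\<^sub>B \<gamma>\<^sub>E K u v =
     exp (- ((K - 1) * (u + 1) / \<gamma>\<^sub>B)) / (\<gamma>\<^sub>E / \<gamma>\<^sub>B * ((u + 1) / (v + 1)) * K + 1)"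

text \<open>The mean of the positive part of \<open>ln\<close> of \<open>sinr_ratio\<close> under
  the same freezing; the kernel of \<open>Lambda\<close>.\<close>

definition secrecy_mean :: "real \<Rightarrow> real \<Rightarrow> real \<Rightarrow> real \<Rightarrow> real" where
  "secrecy_mean \<gamma>\<^sub>B \<gamma>\<^sub>E u v = Psi ((u + 1) / \<gamma>\<^sub>B + (v + 1) / \<gamma>\<^sub>E) - Psi ((u + 1) / \<gamma>\<^sub>B)"

definition sinr_ratio :: "real \<Rightarrow> real \<Rightarrow> real \<Rightarrow> real \<Rightarrow> real" where
  "sinr_ratio x y u v = (1 + x / (u + 1)) / (1 + y / (v + 1))"

lemma secrecy_tail_bounds:
  assumes "0 < \<gamma>\<^sub>B" "0 < \<gamma>\<^sub>E" "1 \<le> K" "0 \<le> u" "0 \<le> v"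
  shows "0 \<le> secrecy_tail \<gamma>\<^sub>B \<gamma>\<^sub>E K u v" "secrecy_tail \<gamma>\<^sub>B \<gamma>\<^sub>E K u v \<le> 1"
proof -
  have "0 \<le> \<gamma>\<^sub>E / \<gamma>\<^sub>B * ((u + 1) / (v + 1)) * K" using assms by simp
  moreover have "exp (- ((K - 1) * (u + 1) / \<gamma>\<^sub>B)) \<le> 1" using assms by simp
  ultimately show "0 \<le> secrecy_tail \<gamma>\<^sub>B \<gamma>\<^sub>E K u v" "secrecy_tail \<gamma>\<^sub>B \<gamma>\<^sub>E K u v \<le> 1"
    unfolding secrecy_tail_def by (simp_all add: divide_le_eq del: exp_le_one_iff times_divide_eq_left times_divide_times_eq times_divide_eq_right)
qed

lemma secrecy_mean_bounds:
  assumes "0 < \<gamma>\<^sub>B" "0 < \<gamma>\<^sub>E" "0 \<le> u" "0 \<le> v"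
  shows "0 \<le> secrecy_mean \<gamma>\<^sub>B \<gamma>\<^sub>E u v" "secrecy_mean \<gamma>\<^sub>B \<gamma>\<^sub>E u v \<le> \<gamma>\<^sub>B"
proof -
  have pos: "0 < (u + 1) / \<gamma>\<^sub>B" "0 < (v + 1) / \<gamma>\<^sub>E" using assms by auto
  show "0 \<le> secrecy_mean \<gamma>\<^sub>B \<gamma>\<^sub>E u v"
    unfolding secrecy_mean_def by (rule Psi_diff(2)[OF pos])
  have "secrecy_mean \<gamma>\<^sub>B \<gamma>\<^sub>E u v \<le> 1 / ((u + 1) / \<gamma>\<^sub>B)"
    unfolding secrecy_mean_def by (rule Psi_diff(3)[OF pos])
  also have "\<dots> \<le> \<gamma>\<^sub>B" using assms by (simp add: field_simps)
  finally show "secrecy_mean \<gamma>\<^sub>B \<gamma>\<^sub>E u v \<le> \<gamma>\<^sub>B" .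
qed

lemma borel_measurable_secrecy_tail [measurable]:
  "case_prod (secrecy_tail \<gamma>\<^sub>B \<gamma>\<^sub>E K) \<in> borel_measurable (borel \<Otimes>\<^sub>M borel)"
  unfolding secrecy_tail_def by measurable

lemma borel_measurable_secrecy_mean [measurable]:
  "case_prod (secrecy_mean \<gamma>\<^sub>B \<gamma>\<^sub>E) \<in> borel_measurable (borel \<Otimes>\<^sub>M borel)"
  unfolding secrecy_mean_def by measurable

lemma sinr_ratio_pos:
  assumes "0 \<le> x" "0 \<le> y" "0 \<le> u" "0 \<le> v"
  shows "0 < sinr_ratio x y u v"
  using assms unfolding sinr_ratio_def by (simp add: add_pos_nonneg)

text \<open>Clearing the positive denominators makes the event affine in \<open>x\<close> and
  \<open>y\<close>, the form in which two exponential variables can be compared by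
  \<open>exponential_race\<close>.\<close>

lemma le_sinr_ratio_iff:
  assumes "0 \<le> y" "0 \<le> u" "0 \<le> v"
  shows "K \<le> sinr_ratio x y u v \<longleftrightarrow> (u + 1) * (K - 1) + K * (u + 1) / (v + 1) * y \<le> x"
proof -
  have "0 < 1 + y / (v + 1)" using assms by (simp add: add_pos_nonneg)
  then have "K \<le> sinr_ratio x y u v \<longleftrightarrow> K * (1 + y / (v + 1)) \<le> 1 + x / (u + 1)"
    by (simp add: sinr_ratio_def pos_le_divide_eq)
  also have "\<dots> \<longleftrightarrow> (u + 1) * (K * (1 + y / (v + 1))) \<le> (u + 1) * (1 + x / (u + 1))"
    using assms by (subst mult_le_cancel_left_pos) auto
  also have "(u + 1) * (1 + x / (u + 1)) = u + 1 + x"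
    using assms by (simp add: distrib_left)
  finally show ?thesis by (simp add: algebra_simps)
qed

section \<open>Averaging one of two independent variables with the other frozen\<close>

lemma (in prob_space) indep_var_nn_integral:
  assumes "indep_var S X T Y" and [measurable]: "f \<in> borel_measurable (S \<Otimes>\<^sub>M T)"
  shows "(\<integral>\<^sup>+\<omega>. f (X \<omega>, Y \<omega>) \<partial>M) = (\<integral>\<^sup>+\<omega>. (\<integral>\<^sup>+\<omega>'. f (X \<omega>', Y \<omega>) \<partial>M) \<partial>M)"
proof -
  from assms(1) have [measurable]: "random_variable S X" "random_variable T Y"
    and eq: "distr M S X \<Otimes>\<^sub>M distr M T Y = distr M (S \<Otimes>\<^sub>M T) (\<lambda>x. (X x, Y x))"
    by (auto simp: indep_var_distribution_eq)
  interpret X: prob_space "distr M S X" by (rule prob_space_distr) fact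
  interpret Y: prob_space "distr M T Y" by (rule prob_space_distr) fact
  interpret XY: pair_prob_space "distr M S X" "distr M T Y" ..
  \<comment> \<open>The joint law is the product of the marginal laws, so Tonelli applies;
    transferring each marginal back to \<open>M\<close> turns the product into two independent
    sample points \<open>\<omega>\<close> and \<open>\<omega>'\<close>.\<close>
  have "(\<integral>\<^sup>+\<omega>. f (X \<omega>, Y \<omega>) \<partial>M) = (\<integral>\<^sup>+z. f z \<partial>(distr M S X \<Otimes>\<^sub>M distr M T Y))"
    unfolding eq by (simp add: nn_integral_distr)
  also have "\<dots> = (\<integral>\<^sup>+y. (\<integral>\<^sup>+x. f (x, y) \<partial>distr M S X) \<partial>distr M T Y)"
    by (rule XY.nn_integral_snd[symmetric]) measurable
  also have "\<dots> = (\<integral>\<^sup>+y. (\<integral>\<^sup>+\<omega>'. f (X \<omega>', y) \<partial>M) \<partial>distr M T Y)"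
    by (intro nn_integral_cong) (simp add: nn_integral_distr)
  also have "\<dots> = (\<integral>\<^sup>+\<omega>. (\<integral>\<^sup>+\<omega>'. f (X \<omega>', Y \<omega>) \<partial>M) \<partial>M)"
    by (subst nn_integral_distr) measurable
  finally show ?thesis .
qed

lemma AE_exponential_nonneg:
  assumes "distributed M lborel X (exponential_density l)"
  shows "AE \<omega> in M. 0 \<le> X \<omega>"
proof -
  have "AE x in distr M lborel X. 0 \<le> x"
    unfolding distributed_distr_eq_density[OF assms]
    by (subst AE_density) (auto simp: exponential_density_def)
  then show ?thesis
    using distributed_measurable[OF assms] by (simp add: AE_distr_iff)
qed

lemma (in prob_space) nn_integral_secrecy_tail:
  assumes X: "distributed M lborel X (exponential_density (1 / \<gamma>\<^sub>B))"
    and Y: "distributed M lborel Y (exponential_density (1 / \<gamma>\<^sub>E))"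
    and indep: "indep_var borel X borel Y"
    and pos: "0 < \<gamma>\<^sub>B" "0 < \<gamma>\<^sub>E" "1 \<le> K" "0 \<le> u" "0 \<le> v"
  shows "(\<integral>\<^sup>+\<omega>. indicator {K..} (sinr_ratio (X \<omega>) (Y \<omega>) u v) \<partial>M) = ennreal (secrecy_tail \<gamma>\<^sub>B \<gamma>\<^sub>E K u v)"
proof -
  have [measurable]: "random_variable borel X" "random_variable borel Y"
    using distributed_measurable[OF X] distributed_measurable[OF Y] by auto
  \<comment> \<open>Intercept and slope of the affine event; \<open>1 \<le> K\<close> makes both
    nonnegative, as the comparison of exponentials requires.\<close>
  let ?a = "(u + 1) * (K - 1)" and ?b = "K * (u + 1) / (v + 1)"
  let ?D = "density lborel (exponential_density (1 / \<gamma>\<^sub>B))"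
  have meas: "(\<lambda>y. emeasure ?D {?a + ?b * y..}) \<in> borel_measurable borel"
    by (rule measurable_emeasure_exponential_atLeast) (use pos in simp)
  have "(\<integral>\<^sup>+\<omega>. indicator {K..} (sinr_ratio (X \<omega>) (Y \<omega>) u v) \<partial>M)
      = (\<integral>\<^sup>+\<omega>. (if ?a + ?b * Y \<omega> \<le> X \<omega> then 1 else 0) \<partial>M)"
  proof (intro nn_integral_cong_AE)
    show "AE \<omega> in M. indicator {K..} (sinr_ratio (X \<omega>) (Y \<omega>) u v) = (if ?a + ?b * Y \<omega> \<le> X \<omega> then 1 else 0 :: ennreal)"
      using AE_exponential_nonneg[OF Y] by eventually_elim (use pos in \<open>simp add: le_sinr_ratio_iff indicator_def\<close>)
  qed
  also have "\<dots> = (\<integral>\<^sup>+\<omega>. (case (X \<omega>, Y \<omega>) of (x, y) \<Rightarrow> if ?a + ?b * y \<le> x then 1 else 0) \<partial>M)"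
    by simp
  also have "\<dots> = (\<integral>\<^sup>+\<omega>. (\<integral>\<^sup>+\<omega>'. (case (X \<omega>', Y \<omega>) of (x, y) \<Rightarrow> if ?a + ?b * y \<le> x then 1 else 0) \<partial>M) \<partial>M)"
    by (rule indep_var_nn_integral[OF indep]) measurable
  also have "\<dots> = (\<integral>\<^sup>+\<omega>. emeasure ?D {?a + ?b * Y \<omega>..} \<partial>M)"
  proof (intro nn_integral_cong)
    fix \<omega>
    have "emeasure ?D {?a + ?b * Y \<omega>..} = emeasure (distr M lborel X) {?a + ?b * Y \<omega>..}"
      by (simp add: distributed_distr_eq_density[OF X])
    also have "\<dots> = (\<integral>\<^sup>+x. indicator {?a + ?b * Y \<omega>..} x \<partial>distr M lborel X)"
      by simp
    also have "\<dots> = (\<integral>\<^sup>+\<omega>'. indicator {?a + ?b * Y \<omega>..} (X \<omega>') \<partial>M)"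
      by (rule nn_integral_distr) auto
    finally show "(\<integral>\<^sup>+\<omega>'. (case (X \<omega>', Y \<omega>) of (x, y) \<Rightarrow> if ?a + ?b * y \<le> x then 1 else 0) \<partial>M) = emeasure ?D {?a + ?b * Y \<omega>..}"
      by (simp add: indicator_def of_bool_def)
  qed
  also have "\<dots> = (\<integral>\<^sup>+y. emeasure ?D {?a + ?b * y..} \<partial>distr M lborel Y)"
    by (subst nn_integral_distr) (use meas in auto)
  also have "\<dots> = ennreal (exp (- (?a * (1 / \<gamma>\<^sub>B))) / (?b * (1 / \<gamma>\<^sub>B) / (1 / \<gamma>\<^sub>E) + 1))"
    unfolding distributed_distr_eq_density[OF Y]
    by (rule exponential_race) (use pos in auto)
  also have "exp (- (?a * (1 / \<gamma>\<^sub>B))) / (?b * (1 / \<gamma>\<^sub>B) / (1 / \<gamma>\<^sub>E) + 1) = secrecy_tail \<gamma>\<^sub>B \<gamma>\<^sub>E K u v"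
    unfolding secrecy_tail_def by (simp add: mult_ac)
  finally show ?thesis .
qed

lemma (in prob_space) nn_integral_secrecy_mean:
  assumes X: "distributed M lborel X (exponential_density (1 / \<gamma>\<^sub>B))"
    and Y: "distributed M lborel Y (exponential_density (1 / \<gamma>\<^sub>E))"
    and indep: "indep_var borel X borel Y"
    and pos: "0 < \<gamma>\<^sub>B" "0 < \<gamma>\<^sub>E" "0 \<le> u" "0 \<le> v"
  shows "(\<integral>\<^sup>+\<omega>. ennreal (max (ln (sinr_ratio (X \<omega>) (Y \<omega>) u v)) 0) \<partial>M) = ennreal (secrecy_mean \<gamma>\<^sub>B \<gamma>\<^sub>E u v)"
proof -
  have [measurable]: "random_variable borel X" "random_variable borel Y"
    using distributed_measurable[OF X] distributed_measurable[OF Y] by auto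
  interpret LM: pair_sigma_finite "lborel :: real measure" M ..
  let ?R = "\<lambda>\<omega>. sinr_ratio (X \<omega>) (Y \<omega>) u v"
  have [measurable]: "?R \<in> borel_measurable M"
    unfolding sinr_ratio_def by measurable
  have "(\<integral>\<^sup>+\<omega>. ennreal (max (ln (?R \<omega>)) 0) \<partial>M)
      = (\<integral>\<^sup>+\<omega>. (\<integral>\<^sup>+K. ennreal (1 / K) * indicator {1..} K * indicator {K..} (?R \<omega>) \<partial>lborel) \<partial>M)"
  proof (intro nn_integral_cong_AE)
    show "AE \<omega> in M. ennreal (max (ln (?R \<omega>)) 0) = (\<integral>\<^sup>+K. ennreal (1 / K) * indicator {1..} K * indicator {K..} (?R \<omega>) \<partial>lborel)"
      using AE_exponential_nonneg[OF X] AE_exponential_nonneg[OF Y]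
      by eventually_elim (use pos in \<open>simp add: nn_integral_ln_layers sinr_ratio_pos\<close>)
  qed
  also have "\<dots> = (\<integral>\<^sup>+K. (\<integral>\<^sup>+\<omega>. ennreal (1 / K) * indicator {1..} K * indicator {K..} (?R \<omega>) \<partial>M) \<partial>lborel)"
  proof (rule LM.Fubini')
    have "(\<lambda>z. ennreal (1 / fst z) * (if 1 \<le> fst z then 1 else 0) * (if fst z \<le> ?R (snd z) then 1 else 0)) \<in> borel_measurable (lborel \<Otimes>\<^sub>M M)"
      by measurable
    then show "(\<lambda>(K, \<omega>). ennreal (1 / K) * indicator {1..} K * indicator {K..} (?R \<omega>)) \<in> borel_measurable (lborel \<Otimes>\<^sub>M M)"
      by (simp add: case_prod_beta' indicator_def)
  qed
  \<comment> \<open>The tail is rewritten with \<open>a = (u + 1) / \<gamma>\<^sub>B\<close> and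
    \<open>c = (v + 1) / \<gamma>\<^sub>E\<close>, whose quotient is the coefficient of
    \<open>K\<close> in its denominator; this is the integrand of \<open>Psi_diff\<close>.\<close>
  also have "\<dots> = (\<integral>\<^sup>+K. ennreal (1 / K) * indicator {1..} K *
      ennreal (exp (- ((K - 1) * ((u + 1) / \<gamma>\<^sub>B))) / ((u + 1) / \<gamma>\<^sub>B / ((v + 1) / \<gamma>\<^sub>E) * K + 1)) \<partial>lborel)"
  proof (intro nn_integral_cong)
    fix K :: real
    have "(\<integral>\<^sup>+\<omega>. ennreal (1 / K) * indicator {1..} K * indicator {K..} (?R \<omega>) \<partial>M)
        = ennreal (1 / K) * indicator {1..} K * (\<integral>\<^sup>+\<omega>. indicator {K..} (?R \<omega>) \<partial>M)"
      by (rule nn_integral_cmult) measurable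
    also have "\<dots> = ennreal (1 / K) * indicator {1..} K *
      ennreal (exp (- ((K - 1) * ((u + 1) / \<gamma>\<^sub>B))) / ((u + 1) / \<gamma>\<^sub>B / ((v + 1) / \<gamma>\<^sub>E) * K + 1))"
    proof (cases "1 \<le> K")
      case True
      show ?thesis
        by (subst nn_integral_secrecy_tail[OF X Y indep pos(1,2) True pos(3,4)])
           (simp add: secrecy_tail_def mult_ac)
    qed simp
    finally show "(\<integral>\<^sup>+\<omega>. ennreal (1 / K) * indicator {1..} K * indicator {K..} (?R \<omega>) \<partial>M) = ennreal (1 / K) * indicator {1..} K *
      ennreal (exp (- ((K - 1) * ((u + 1) / \<gamma>\<^sub>B))) / ((u + 1) / \<gamma>\<^sub>B / ((v + 1) / \<gamma>\<^sub>E) * K + 1))" .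
  qed
  also have "\<dots> = ennreal (secrecy_mean \<gamma>\<^sub>B \<gamma>\<^sub>E u v)"
    unfolding secrecy_mean_def by (rule Psi_diff(1)) (use pos in auto)
  finally show ?thesis .
qed

section \<open>Densities and expectations of kernels\<close>

lemma (in prob_space) distributed_prob_density:
  assumes U: "distributed M lborel U h"
  shows "distributed M lborel U (\<lambda>x. ennreal (prob_density M U x))"
proof -
  have [measurable]: "random_variable lborel U"
    using distributed_measurable[OF U] .
  let ?N = "distr M lborel U"
  interpret N: prob_space ?N by (rule prob_space_distr) fact
  have eq: "density lborel h = ?N"
    using distributed_distr_eq_density[OF U] by simp
  \<comment> \<open>Some density \<open>h\<close> exists, so the law is absolutely continuous and
    its Radon-Nikodym derivative is a density as well.\<close>
  have ac: "absolutely_continuous lborel ?N"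
    using distributed_borel_measurable[OF U]
    unfolding eq[symmetric] by (intro absolutely_continuousI_density) simp
  \<comment> \<open>The law is a finite measure, so its derivative is finite almost everywhere and
    \<open>enn2real\<close> changes it on a null set only.\<close>
  have fin: "AE x in lborel. RN_deriv lborel ?N x \<noteq> \<infinity>"
    by (rule sigma_finite_measure.RN_deriv_finite[OF sigma_finite_lborel N.sigma_finite_measure ac]) simp
  have "?N = density lborel (RN_deriv lborel ?N)"
    using sigma_finite_measure.density_RN_deriv[OF sigma_finite_lborel ac] by simp
  also have "\<dots> = density lborel (\<lambda>x. ennreal (prob_density M U x))"
  proof (rule density_cong)
    show "AE x in lborel. RN_deriv lborel ?N x = ennreal (prob_density M U x)"
      using fin by eventually_elim (simp add: prob_density_def less_top)
  qed (auto simp: prob_density_def)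
  finally show ?thesis
    unfolding distributed_def using distributed_measurable[OF U] by (simp add: prob_density_def)
qed

lemma (in prob_space) expectation_kernel_densities:
  fixes T :: "real \<Rightarrow> real \<Rightarrow> real"
  assumes U: "distributed M lborel U (\<lambda>x. ennreal (f x))" and f: "\<And>x. 0 \<le> f x"
    and V: "distributed M lborel V (\<lambda>x. ennreal (g x))" and g: "\<And>x. 0 \<le> g x"
    and indep: "indep_var borel U borel V"
    and nonneg: "AE \<omega> in M. 0 \<le> U \<omega>" "AE \<omega> in M. 0 \<le> V \<omega>"
    and [measurable]: "case_prod T \<in> borel_measurable (borel \<Otimes>\<^sub>M borel)"
    and bound: "\<And>u v. 0 \<le> u \<Longrightarrow> 0 \<le> v \<Longrightarrow> \<bar>T u v\<bar> \<le> B"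
  shows "(LBINT y:{0..}. (LBINT x:{0..}. T x y * f x * g y)) = expectation (\<lambda>\<omega>. T (U \<omega>) (V \<omega>))"
proof -
  have [measurable]: "random_variable borel U" "random_variable borel V"
    using distributed_measurable[OF U] distributed_measurable[OF V] by auto
  \<comment> \<open>The bound on \<open>T\<close> holds on the quadrant only. Cutting
    \<open>T\<close> off outside it changes nothing almost surely, makes the function bounded and
    hence integrable, as Fubini demands, and produces the ranges \<open>{0..}\<close> of the double
    integral.\<close>
  define T' where "T' = (\<lambda>(u, v). if 0 \<le> u \<and> 0 \<le> v then T u v else 0)"
  have [measurable]: "T' \<in> borel_measurable (borel \<Otimes>\<^sub>M borel)"
    unfolding T'_def by measurable
  have B: "\<bar>T' z\<bar> \<le> \<bar>B\<bar>" for z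
    using bound[of "fst z" "snd z"] by (auto simp: T'_def split: prod.split)
  have "indep_var lborel U lborel V"
    using indep unfolding indep_var_eq by simp
  then have "distributed M (lborel \<Otimes>\<^sub>M lborel) (\<lambda>\<omega>. (U \<omega>, V \<omega>)) (\<lambda>(x, y). ennreal (f x) * ennreal (g y))"
    by (intro distributed_joint_indep U V sigma_finite_lborel)
  then have UV: "distributed M (lborel \<Otimes>\<^sub>M lborel) (\<lambda>\<omega>. (U \<omega>, V \<omega>)) (\<lambda>z. ennreal (f (fst z) * g (snd z)))"
    using f g by (simp add: ennreal_mult case_prod_beta')
  have "integrable M (\<lambda>\<omega>. T' (U \<omega>, V \<omega>))"
    by (rule integrable_const_bound[where B="\<bar>B\<bar>"]) (use B in auto)
  then have int: "integrable (lborel \<Otimes>\<^sub>M lborel) (\<lambda>z. f (fst z) * g (snd z) * T' z)"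
    using distributed_integrable[OF UV, of T'] f g by simp
  have "expectation (\<lambda>\<omega>. T (U \<omega>) (V \<omega>)) = expectation (\<lambda>\<omega>. T' (U \<omega>, V \<omega>))"
  proof (intro integral_cong_AE)
    show "AE \<omega> in M. T (U \<omega>) (V \<omega>) = T' (U \<omega>, V \<omega>)"
      using nonneg by eventually_elim (simp add: T'_def)
  qed measurable
  also have "\<dots> = (\<integral>z. f (fst z) * g (snd z) * T' z \<partial>(lborel \<Otimes>\<^sub>M lborel))"
    using distributed_integral[OF UV, of T'] f g by simp
  also have "\<dots> = (\<integral>y. (\<integral>x. f x * g y * T' (x, y) \<partial>lborel) \<partial>lborel)"
    using lborel_pair.integral_snd[of "\<lambda>x y. f x * g y * T' (x, y)"] int by (simp add: case_prod_beta')
  also have "\<dots> = (LBINT y:{0..}. (LBINT x:{0..}. T x y * f x * g y))"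
    unfolding set_lebesgue_integral_def
    by (intro Bochner_Integration.integral_cong refl)
       (auto simp: T'_def indicator_def mult_ac intro!: Bochner_Integration.integral_cong)
  finally show ?thesis by simp
qed

text \<open>Existence of a density is enough, because \<open>prob_density\<close> recovers it from
  the law. Convolution adds one summand at a time; the induction starts at a singleton, since the
  empty sum is constant and has no density.\<close>

lemma (in prob_space) distributed_sum_indep:
  fixes X :: "'i \<Rightarrow> 'a \<Rightarrow> real"
  assumes "finite I" "I \<noteq> {}" "indep_vars (\<lambda>_. borel) X I"
    and "\<And>i. i \<in> I \<Longrightarrow> \<exists>h. distributed M lborel (X i) h"
  shows "\<exists>h. distributed M lborel (\<lambda>\<omega>. \<Sum>i\<in>I. X i \<omega>) h"
  using assms
proof (induction rule: finite_ne_induct)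
  case (insert i I)
  obtain h where h: "distributed M lborel (\<lambda>\<omega>. \<Sum>i\<in>I. X i \<omega>) h"
    using insert.IH insert.prems indep_vars_subset[OF insert.prems(1), of I] by auto
  obtain k where k: "distributed M lborel (X i) k"
    using insert.prems by auto
  have "indep_var borel (X i) borel (\<lambda>\<omega>. \<Sum>i\<in>I. X i \<omega>)"
    using insert by (intro indep_vars_sum) auto
  from distributed_convolution[OF this k h] insert show ?case
    by auto
qed auto

section \<open>Independence of signals, interferences and allocations\<close>

text \<open>
  Allocations are encoded as real numbers, so that all network variables have the same type and
  the library results on \<open>indep_vars\<close> become available.
\<close>

definition allocation_code :: "nat option \<Rightarrow> real" where
  "allocation_code a = (case a of None \<Rightarrow> 0 | Some i \<Rightarrow> real i + 1)"

definition network_var ::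
  "(transmitter \<Rightarrow> receiver \<Rightarrow> 'a \<Rightarrow> real) \<Rightarrow> (nat \<Rightarrow> 'a \<Rightarrow> nat option) \<Rightarrow>
   (transmitter \<times> receiver) + nat \<Rightarrow> 'a \<Rightarrow> real" where
  "network_var SNR alloc l = (case l of Inl (a, b) \<Rightarrow> SNR a b | Inr j \<Rightarrow> \<lambda>\<omega>. allocation_code (alloc j \<omega>))"

lemma network_var_simps [simp]:
  "network_var SNR alloc (Inl (a, b)) = SNR a b"
  "network_var SNR alloc (Inr j) = (\<lambda>\<omega>. allocation_code (alloc j \<omega>))"
  by (simp_all add: network_var_def)

text \<open>The shift by one in the code keeps \<open>Some 0\<close> apart from
  \<open>None\<close>.\<close>

lemma allocation_code_eq_iff:
  "allocation_code a = 0 \<longleftrightarrow> a = None"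
  "allocation_code a = real i + 1 \<longleftrightarrow> a = Some i"
  by (auto simp: allocation_code_def split: option.split)

lemma (in prob_space) indep_vars_disjoint_functions:
  assumes "indep_vars M' X I" "A \<inter> B = {}" "A \<subseteq> I" "B \<subseteq> I"
    and "F \<in> measurable (PiM A M') S" "G \<in> measurable (PiM B M') T"
  shows "indep_var S (\<lambda>\<omega>. F (\<lambda>i\<in>A. X i \<omega>)) T (\<lambda>\<omega>. G (\<lambda>i\<in>B. X i \<omega>))"
  using indep_var_compose[OF indep_var_restrict[OF assms(1-4)] assms(5,6)] by (simp add: o_def)

text \<open>\<open>indep_var\<close> relates variables with values in one type. Independence is
  therefore used for the two restrictions of the family, which share a type, and \<open>F\<close>
  and \<open>G\<close>, whose targets may differ in type, are moved into the integrand.\<close>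

lemma (in prob_space) indep_vars_disjoint_functions_nn_integral:
  assumes "indep_vars M' X I" "A \<inter> B = {}" "A \<subseteq> I" "B \<subseteq> I"
    and [measurable]: "F \<in> measurable (PiM A M') S" "G \<in> measurable (PiM B M') T"
    and [measurable]: "f \<in> borel_measurable (S \<Otimes>\<^sub>M T)"
  shows "(\<integral>\<^sup>+\<omega>. f (F (\<lambda>i\<in>A. X i \<omega>), G (\<lambda>i\<in>B. X i \<omega>)) \<partial>M) =
    (\<integral>\<^sup>+\<omega>. (\<integral>\<^sup>+\<omega>'. f (F (\<lambda>i\<in>A. X i \<omega>'), G (\<lambda>i\<in>B. X i \<omega>)) \<partial>M) \<partial>M)"
  using indep_var_nn_integral[OF indep_var_restrict[OF assms(1-4)], of "\<lambda>z. f (F (fst z), G (snd z))"]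
  by simp

section \<open>The law of a single allocation\<close>

lemma pmf_allocation:
  assumes "n \<ge> 1" "p \<in> {0..1}"
  shows "pmf (allocation_pmf p n) None = 1 - p"
    and "i \<in> {1..n} \<Longrightarrow> pmf (allocation_pmf p n) (Some i) = p / real n"
proof -
  have "pmf (map_pmf Some (pmf_of_set {1..n})) None = 0"
    by (rule pmf_map_outside) auto
  then show "pmf (allocation_pmf p n) None = 1 - p"
    using assms by (simp add: allocation_pmf_def pmf_bind)
  assume "i \<in> {1..n}"
  moreover have "pmf (map_pmf Some (pmf_of_set {1..n})) (Some i) = pmf (pmf_of_set {1..n}) i"
    by (rule pmf_map_inj') simp
  ultimately show "pmf (allocation_pmf p n) (Some i) = p / real n"
    using assms by (simp add: allocation_pmf_def pmf_bind)
qed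

text \<open>For one pair: reuse of the spectrum of CUE \<open>i\<close>, anything else, and underlay
  mode on another CUE. The last probability is \<open>1 - (1 - p) - p / n\<close>.\<close>

lemma measure_allocation:
  assumes "n \<ge> 1" "p \<in> {0..1}" "i \<in> {1..n}"
  shows "measure (allocation_pmf p n) {Some i} = p / real n"
    and "measure (allocation_pmf p n) (- {Some i}) = 1 - p / real n"
    and "measure (allocation_pmf p n) (- {None, Some i}) = p * (1 - 1 / real n)"
proof -
  show Some: "measure (allocation_pmf p n) {Some i} = p / real n"
    using pmf_allocation(2)[OF assms] by (simp add: measure_pmf_single)
  show "measure (allocation_pmf p n) (- {Some i}) = 1 - p / real n"
    using measure_pmf.prob_compl[of "{Some i}" "allocation_pmf p n"] Some by (simp add: Compl_eq_Diff_UNIV)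
  have "measure (allocation_pmf p n) {None, Some i} = (1 - p) + p / real n"
    using assms by (subst measure_measure_pmf_finite) (auto simp: pmf_allocation)
  then show "measure (allocation_pmf p n) (- {None, Some i}) = p * (1 - 1 / real n)"
    using measure_pmf.prob_compl[of "{None, Some i}" "allocation_pmf p n"]
    by (simp add: Compl_eq_Diff_UNIV algebra_simps)
qed

context d2d_network
begin

lemma SNR_measurable: "(a, b) \<in> links n m \<Longrightarrow> random_variable borel (SNR a b)"
  using distributed_measurable[OF SNR_exponential] by simp

lemma SNR_nonneg: "(a, b) \<in> links n m \<Longrightarrow> AE \<omega> in M. 0 \<le> SNR a b \<omega>"
  by (rule AE_exponential_nonneg[OF SNR_exponential])

text \<open>Every event described by a coded allocation is an event described by the allocation
  itself, so independence passes to the smaller families of events.\<close>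

lemma indep_network_var: "indep_vars (\<lambda>_. borel) (network_var SNR alloc) (links n m <+> {1..m})"
  unfolding indep_vars_def2
proof (intro conjI ballI)
  fix l assume "l \<in> links n m <+> {1..m}"
  moreover have "random_variable borel (\<lambda>\<omega>. allocation_code (alloc j \<omega>))" if "j \<in> {1..m}" for j
    by (rule measurable_compose[OF alloc_measurable[OF that]]) simp
  ultimately show "random_variable borel (network_var SNR alloc l)"
    by (auto simp: SNR_measurable)
next
  show "indep_sets (\<lambda>l. {network_var SNR alloc l -` A \<inter> space M |A. A \<in> sets borel}) (links n m <+> {1..m})"
  proof (rule indep_sets_mono_sets[OF mutually_independent])
    fix l assume "l \<in> links n m <+> {1..m}"
    have "(\<lambda>\<omega>. allocation_code (alloc j \<omega>)) -` A = alloc j -` (allocation_code -` A)" for j A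
      by auto
    then show "{network_var SNR alloc l -` A \<inter> space M |A. A \<in> sets borel}
      \<subseteq> case_sum (\<lambda>(a, b). {SNR a b -` S \<inter> space M | S. S \<in> sets borel})
            (\<lambda>j. {alloc j -` S \<inter> space M | S. S \<in> sets (count_space UNIV)}) l"
      by (cases l) (auto simp: split: prod.split)
  qed
qed

lemma interference_network_var:
  assumes "(\<lambda>k. Inl (D2D_tx k, b)) ` D \<subseteq> A"
  shows "(\<Sum>k\<in>D. (\<lambda>l\<in>A. network_var SNR alloc l \<omega>) (Inl (D2D_tx k, b))) = interference SNR D b \<omega>"
  unfolding interference_def using assms by (intro sum.cong) auto

lemma CUE_links: "i \<in> {1..n} \<Longrightarrow> (CUE i, BS) \<in> links n m" "i \<in> {1..n} \<Longrightarrow> (CUE i, Eve) \<in> links n m"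
  by (auto simp: links_def)

lemma D2D_links: "k \<in> {1..m} \<Longrightarrow> (D2D_tx k, BS) \<in> links n m" "k \<in> {1..m} \<Longrightarrow> (D2D_tx k, Eve) \<in> links n m"
  by (auto simp: links_def)

lemma interference_measurable:
  "D \<subseteq> {1..m} \<Longrightarrow> b \<in> {BS, Eve} \<Longrightarrow> random_variable borel (interference SNR D b)"
  unfolding interference_def using D2D_links by (intro borel_measurable_sum SNR_measurable) auto

lemma interference_nonneg:
  assumes "D \<subseteq> {1..m}" "b \<in> {BS, Eve}"
  shows "AE \<omega> in M. 0 \<le> interference SNR D b \<omega>"
proof -
  have "AE \<omega> in M. \<forall>k\<in>D. 0 \<le> SNR (D2D_tx k) b \<omega>"
    using assms D2D_links finite_subset[OF assms(1)] by (intro AE_finite_allI SNR_nonneg) auto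
  then show ?thesis
    unfolding interference_def by eventually_elim (simp add: sum_nonneg)
qed

lemma interference_distributed:
  assumes "D \<subseteq> {1..m}" "D \<noteq> {}" "b \<in> {BS, Eve}"
  shows "distributed M lborel (interference SNR D b) (\<lambda>x. ennreal (prob_density M (interference SNR D b) x))"
proof -
  have links: "(D2D_tx k, b) \<in> links n m" if "k \<in> D" for k
    using assms that D2D_links by auto
  \<comment> \<open>Singleton blocks re-index the family by the pairs \<open>k\<close> in place of
    the links; evaluating each block at its only point gives back the SNR.\<close>
  have "indep_vars (\<lambda>_. borel) (\<lambda>k. network_var SNR alloc (Inl (D2D_tx k, b))) D"
  proof -
    have "indep_vars (\<lambda>k. PiM {Inl (D2D_tx k, b)} (\<lambda>_. borel))
        (\<lambda>k \<omega>. \<lambda>l\<in>{Inl (D2D_tx k, b)}. network_var SNR alloc l \<omega>) D"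
      by (rule indep_vars_restrict[OF indep_network_var]) (auto simp: links disjoint_family_on_def)
    then have "indep_vars (\<lambda>_. borel)
        (\<lambda>k \<omega>. (\<lambda>z. z (Inl (D2D_tx k, b))) (\<lambda>l\<in>{Inl (D2D_tx k, b)}. network_var SNR alloc l \<omega>)) D"
      by (rule indep_vars_compose2) simp
    then show ?thesis by simp
  qed
  then have "\<exists>h. distributed M lborel (\<lambda>\<omega>. \<Sum>k\<in>D. SNR (D2D_tx k) b \<omega>) h"
    using assms SNR_exponential[OF links] finite_subset[OF assms(1)]
    by (intro distributed_sum_indep) auto
  then obtain h where "distributed M lborel (interference SNR D b) h"
    unfolding interference_def by auto
  then show ?thesis by (rule distributed_prob_density)
qed

lemma indep_signals:
  assumes "i \<in> {1..n}"
  shows "indep_var borel (SNR (CUE i) BS) borel (SNR (CUE i) Eve)"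
proof -
  let ?A = "{Inl (CUE i, BS)} :: ((transmitter \<times> receiver) + nat) set"
  let ?B = "{Inl (CUE i, Eve)} :: ((transmitter \<times> receiver) + nat) set"
  have "indep_var borel (\<lambda>\<omega>. (\<lambda>z. z (Inl (CUE i, BS))) (\<lambda>l\<in>?A. network_var SNR alloc l \<omega>))
      borel (\<lambda>\<omega>. (\<lambda>z. z (Inl (CUE i, Eve))) (\<lambda>l\<in>?B. network_var SNR alloc l \<omega>))"
    by (rule indep_vars_disjoint_functions[OF indep_network_var]) (use assms in \<open>auto simp: CUE_links\<close>)
  then show ?thesis by simp
qed

lemma interference_component_measurable:
  assumes "(\<lambda>k. Inl (D2D_tx k, b)) ` D \<subseteq> A"
  shows "(\<lambda>z. \<Sum>k\<in>D. z (Inl (D2D_tx k, b))) \<in> borel_measurable (PiM A (\<lambda>_. borel :: real measure))"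
  using assms by (intro borel_measurable_sum measurable_component_singleton) auto

lemma indep_interferences:
  assumes "D \<subseteq> {1..m}"
  shows "indep_var borel (interference SNR D BS) borel (interference SNR D Eve)"
proof -
  let ?L = "\<lambda>b. (\<lambda>k. Inl (D2D_tx k, b)) ` D :: ((transmitter \<times> receiver) + nat) set"
  have "indep_var borel (\<lambda>\<omega>. \<Sum>k\<in>D. (\<lambda>l\<in>?L BS. network_var SNR alloc l \<omega>) (Inl (D2D_tx k, BS)))
      borel (\<lambda>\<omega>. \<Sum>k\<in>D. (\<lambda>l\<in>?L Eve. network_var SNR alloc l \<omega>) (Inl (D2D_tx k, Eve)))"
    by (rule indep_vars_disjoint_functions[OF indep_network_var, where F = "\<lambda>z. \<Sum>k\<in>D. z (Inl (D2D_tx k, BS))"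
          and G = "\<lambda>z. \<Sum>k\<in>D. z (Inl (D2D_tx k, Eve))"])
       (use assms D2D_links interference_component_measurable in auto)
  then show ?thesis by (simp only: interference_network_var order_refl)
qed

lemma indep_signals_interferences:
  assumes "D \<subseteq> {1..m}" "i \<in> {1..n}"
  shows "indep_var (borel \<Otimes>\<^sub>M borel) (\<lambda>\<omega>. (SNR (CUE i) BS \<omega>, SNR (CUE i) Eve \<omega>))
     (borel \<Otimes>\<^sub>M borel) (\<lambda>\<omega>. (interference SNR D BS \<omega>, interference SNR D Eve \<omega>))"
proof -
  let ?A = "{Inl (CUE i, BS), Inl (CUE i, Eve)} :: ((transmitter \<times> receiver) + nat) set"
  let ?B = "(\<lambda>k. Inl (D2D_tx k, BS)) ` D \<union> (\<lambda>k. Inl (D2D_tx k, Eve)) ` D :: ((transmitter \<times> receiver) + nat) set"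
  let ?F = "\<lambda>z :: _ \<Rightarrow> real. (z (Inl (CUE i, BS)), z (Inl (CUE i, Eve)))"
  let ?G = "\<lambda>z :: _ \<Rightarrow> real. (\<Sum>k\<in>D. z (Inl (D2D_tx k, BS)), \<Sum>k\<in>D. z (Inl (D2D_tx k, Eve)))"
  have "indep_var (borel \<Otimes>\<^sub>M borel) (\<lambda>\<omega>. ?F (\<lambda>l\<in>?A. network_var SNR alloc l \<omega>))
      (borel \<Otimes>\<^sub>M borel) (\<lambda>\<omega>. ?G (\<lambda>l\<in>?B. network_var SNR alloc l \<omega>))"
  proof (rule indep_vars_disjoint_functions[OF indep_network_var, where F = ?F and G = ?G])
    show "?G \<in> measurable (PiM ?B (\<lambda>_. borel)) (borel \<Otimes>\<^sub>M borel)"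
      by (intro measurable_Pair interference_component_measurable) auto
  qed (use assms D2D_links CUE_links in auto)
  then show ?thesis by (simp add: interference_network_var del: restrict_apply) simp
qed

text \<open>With \<open>D\<close> fixed in advance, the interferences depend on the links alone and
  the event \<open>W\<close> on the allocations alone. These are disjoint groups of indices, so the
  event can be averaged separately from the signals.\<close>

lemma nn_integral_allocation_signals:
  fixes D i c
  defines "Q \<equiv> \<lambda>\<omega>. ((SNR (CUE i) BS \<omega>, SNR (CUE i) Eve \<omega>), (interference SNR D BS \<omega>, interference SNR D Eve \<omega>))"
    and "W \<equiv> \<lambda>\<omega>. underlay_pairs m alloc i \<omega> = D \<and> (overlay_pairs m alloc \<omega> = {}) = c"
  assumes "D \<subseteq> {1..m}" "i \<in> {1..n}"
    and f: "f \<in> borel_measurable (count_space UNIV \<Otimes>\<^sub>M ((borel \<Otimes>\<^sub>M borel) \<Otimes>\<^sub>M (borel \<Otimes>\<^sub>M borel)))"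
  shows "(\<integral>\<^sup>+\<omega>. f (W \<omega>, Q \<omega>) \<partial>M) = (\<integral>\<^sup>+\<omega>. (\<integral>\<^sup>+\<omega>'. f (W \<omega>', Q \<omega>) \<partial>M) \<partial>M)"
proof -
  let ?A = "Inr ` {1..m} :: ((transmitter \<times> receiver) + nat) set"
  let ?B = "Inl ` links n m :: ((transmitter \<times> receiver) + nat) set"
  \<comment> \<open>The event \<open>W\<close> in terms of codes: \<open>real i + 1\<close> means
    reuse of the spectrum of CUE \<open>i\<close>, and 0 means overlay mode.\<close>
  let ?F = "\<lambda>z :: _ \<Rightarrow> real. (\<forall>j\<in>{1..m}. (z (Inr j) = real i + 1) = (j \<in> D)) \<and> (\<forall>j\<in>{1..m}. z (Inr j) \<noteq> 0) = c"
  let ?G = "\<lambda>z :: _ \<Rightarrow> real. ((z (Inl (CUE i, BS)), z (Inl (CUE i, Eve))),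
      (\<Sum>k\<in>D. z (Inl (D2D_tx k, BS)), \<Sum>k\<in>D. z (Inl (D2D_tx k, Eve))))"
  have links: "(\<lambda>k. Inl (D2D_tx k, BS)) ` D \<subseteq> ?B" "(\<lambda>k. Inl (D2D_tx k, Eve)) ` D \<subseteq> ?B"
    "Inl (CUE i, BS) \<in> ?B" "Inl (CUE i, Eve) \<in> ?B"
    using assms D2D_links CUE_links by auto
  have F: "?F (\<lambda>l\<in>?A. network_var SNR alloc l \<omega>) = W \<omega>" for \<omega>
    using assms(3) by (auto simp: W_def allocation_code_eq_iff underlay_pairs_def overlay_pairs_def)
  have G: "?G (\<lambda>l\<in>?B. network_var SNR alloc l \<omega>) = Q \<omega>" for \<omega>
    using links(3,4) by (simp add: Q_def interference_network_var[OF links(1)] interference_network_var[OF links(2)] del: restrict_apply) simp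
  have "(\<integral>\<^sup>+\<omega>. f (?F (\<lambda>l\<in>?A. network_var SNR alloc l \<omega>), ?G (\<lambda>l\<in>?B. network_var SNR alloc l \<omega>)) \<partial>M) =
    (\<integral>\<^sup>+\<omega>. (\<integral>\<^sup>+\<omega>'. f (?F (\<lambda>l\<in>?A. network_var SNR alloc l \<omega>'), ?G (\<lambda>l\<in>?B. network_var SNR alloc l \<omega>)) \<partial>M) \<partial>M)"
  proof (rule indep_vars_disjoint_functions_nn_integral[OF indep_network_var, where F = ?F and G = ?G])
    show "?G \<in> measurable (PiM ?B (\<lambda>_. borel)) ((borel \<Otimes>\<^sub>M borel) \<Otimes>\<^sub>M (borel \<Otimes>\<^sub>M borel))"
      using links by (intro measurable_Pair interference_component_measurable measurable_component_singleton)
    have [measurable]: "(\<lambda>z. z (Inr j)) \<in> borel_measurable (PiM ?A (\<lambda>_. borel :: real measure))" if "j \<in> {1..m}" for j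
      using that by (intro measurable_component_singleton) auto
    show "?F \<in> measurable (PiM ?A (\<lambda>_. borel)) (count_space UNIV)"
      by measurable
  qed (use f in auto)
  then show ?thesis unfolding F G .
qed

section \<open>Conditioning on the allocation\<close>

lemma prob_alloc_product:
  assumes "m \<ge> 1"
  shows "prob {\<omega> \<in> space M. \<forall>j\<in>{1..m}. alloc j \<omega> \<in> S j} = (\<Prod>j\<in>{1..m}. measure (allocation_pmf p n) (S j))"
proof -
  let ?E = "\<lambda>j. alloc j -` S j \<inter> space M"
  let ?J = "Inr ` {1..m} :: ((transmitter \<times> receiver) + nat) set"
  \<comment> \<open>Independence applied to the allocation indices; the \<open>Inl\<close> branch is
    a filler, as \<open>?J\<close> consists of \<open>Inr\<close> indices, and
    \<open>m \<ge> 1\<close> makes \<open>?J\<close> nonempty.\<close>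
  have "prob (\<Inter>l\<in>?J. case_sum (\<lambda>_. {}) ?E l) = (\<Prod>l\<in>?J. prob (case_sum (\<lambda>_. {}) ?E l))"
    by (rule indep_setsD[OF mutually_independent, where J = ?J and A = "case_sum (\<lambda>_. {}) ?E"])
       (use assms in auto)
  moreover have "(\<Inter>l\<in>?J. case_sum (\<lambda>_. {}) ?E l) = {\<omega> \<in> space M. \<forall>j\<in>{1..m}. alloc j \<omega> \<in> S j}"
    using assms by auto
  moreover have "(\<Prod>l\<in>?J. prob (case_sum (\<lambda>_. {}) ?E l)) = (\<Prod>j\<in>{1..m}. prob (?E j))"
    by (subst prod.reindex) auto
  moreover have "prob (?E j) = measure (allocation_pmf p n) (S j)" if "j \<in> {1..m}" for j
    using measure_distr[OF alloc_measurable[OF that], of "S j"] alloc_distr[OF that] by simp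
  ultimately show ?thesis by simp
qed

lemma alloc_pred_measurable:
  "j \<in> {1..m} \<Longrightarrow> Measurable.pred M (\<lambda>\<omega>. alloc j \<omega> = a)"
  by (rule measurable_compose[OF alloc_measurable]) auto

lemma allocation_event_measurable:
  "Measurable.pred M (\<lambda>\<omega>. underlay_pairs m alloc i \<omega> = D \<and> (overlay_pairs m alloc \<omega> = {}) = c)"
proof -
  \<comment> \<open>Finitely many conditions on single pairs decide the event; the constant conjunct
    \<open>D \<subseteq> {1..m}\<close> makes it empty for a set that cannot occur.\<close>
  have "(underlay_pairs m alloc i \<omega> = D \<and> (overlay_pairs m alloc \<omega> = {}) = c) \<longleftrightarrow>
     D \<subseteq> {1..m} \<and> (\<forall>j\<in>{1..m}. (alloc j \<omega> = Some i) = (j \<in> D)) \<and> (\<forall>j\<in>{1..m}. \<not> alloc j \<omega> = None) = c" for \<omega>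
    by (auto simp: underlay_pairs_def overlay_pairs_def)
  moreover note [measurable] = alloc_pred_measurable
  have "Measurable.pred M (\<lambda>\<omega>. D \<subseteq> {1..m} \<and> (\<forall>j\<in>{1..m}. (alloc j \<omega> = Some i) = (j \<in> D)) \<and> (\<forall>j\<in>{1..m}. \<not> alloc j \<omega> = None) = c)"
    by measurable
  ultimately show ?thesis by simp
qed

text \<open>Without overlay pairs, each pair in \<open>D\<close> reuses CUE \<open>i\<close> and
  each other pair reuses another CUE, which is a product event. The presence of an overlay pair is
  not, so its probability is the difference between the product event for \<open>D\<close> alone and
  the former.\<close>

lemma prob_allocation_event:
  assumes m: "m \<ge> 1" and n: "n \<ge> 1" "p \<in> {0..1}" "i \<in> {1..n}" and D: "D \<subseteq> {1..m}"
    and \<epsilon>: "\<epsilon> = p / real n" and \<theta>: "\<theta> = p * (1 - 1 / real n)"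
  shows "prob {\<omega> \<in> space M. underlay_pairs m alloc i \<omega> = D \<and> (overlay_pairs m alloc \<omega> = {}) = c} =
    \<epsilon> ^ card D * (if c then \<theta> ^ (m - card D) else (1 - \<epsilon>) ^ (m - card D) - \<theta> ^ (m - card D))"
proof -
  let ?E = "\<lambda>c. {\<omega> \<in> space M. underlay_pairs m alloc i \<omega> = D \<and> (overlay_pairs m alloc \<omega> = {}) = c}"
  let ?U = "{\<omega> \<in> space M. underlay_pairs m alloc i \<omega> = D}"
  have prod: "(\<Prod>j\<in>{1..m}. if j \<in> D then a else b) = a ^ card D * b ^ (m - card D)" for a b :: real
  proof -
    have "card ({1..m} - D) = m - card D"
      using D by (simp add: card_Diff_subset finite_subset)
    moreover have "{1..m} \<inter> D = D" using D by auto
    ultimately show ?thesis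
      by (simp add: prod.If_cases Diff_eq[symmetric])
  qed
  have "?E True = {\<omega> \<in> space M. \<forall>j\<in>{1..m}. alloc j \<omega> \<in> (if j \<in> D then {Some i} else - {None, Some i})}"
    using D by (auto simp: underlay_pairs_def overlay_pairs_def split: if_splits)
  then have "prob (?E True) = (\<Prod>j\<in>{1..m}. measure (allocation_pmf p n) (if j \<in> D then {Some i} else - {None, Some i}))"
    by (simp only: prob_alloc_product[OF m])
  also have "\<dots> = (\<Prod>j\<in>{1..m}. if j \<in> D then \<epsilon> else \<theta>)"
    using measure_allocation[OF n] by (intro prod.cong) (simp_all add: \<epsilon> \<theta>)
  finally have T: "prob (?E True) = \<epsilon> ^ card D * \<theta> ^ (m - card D)"
    by (simp only: prod)
  have "?U = {\<omega> \<in> space M. \<forall>j\<in>{1..m}. alloc j \<omega> \<in> (if j \<in> D then {Some i} else - {Some i})}"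
    using D by (auto simp: underlay_pairs_def split: if_splits)
  then have "prob ?U = (\<Prod>j\<in>{1..m}. measure (allocation_pmf p n) (if j \<in> D then {Some i} else - {Some i}))"
    by (simp only: prob_alloc_product[OF m])
  also have "\<dots> = (\<Prod>j\<in>{1..m}. if j \<in> D then \<epsilon> else 1 - \<epsilon>)"
    using measure_allocation[OF n] by (intro prod.cong) (simp_all add: \<epsilon>)
  finally have U: "prob ?U = \<epsilon> ^ card D * (1 - \<epsilon>) ^ (m - card D)"
    by (simp only: prod)
  have sets: "?E c \<in> events" for c
    using allocation_event_measurable[of i D c] by simp
  have "?U = ?E True \<union> ?E False" "?E True \<inter> ?E False = {}" by auto
  then have "prob ?U = prob (?E True) + prob (?E False)"
    using finite_measure_Union[OF sets sets, of True False] by (simp only:)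
  then show ?thesis using T U by (cases c) (simp_all add: algebra_simps)
qed

text \<open>Independence is used twice: the allocation event factors out as a probability, and then
  the signals are averaged with the interferences frozen, which produces \<open>T\<close>. Leaving
  \<open>h\<close> and \<open>T\<close> abstract covers both the tail and the mean.\<close>

lemma nn_integral_allocation_ratio:
  assumes D: "D \<subseteq> {1..m}" and i: "i \<in> {1..n}"
    and h: "h \<in> borel_measurable borel"
    and T: "case_prod T \<in> borel_measurable (borel \<Otimes>\<^sub>M borel)"
    and bound: "\<And>u v. 0 \<le> u \<Longrightarrow> 0 \<le> v \<Longrightarrow> 0 \<le> T u v \<and> T u v \<le> B"
    and eq: "\<And>u v. 0 \<le> u \<Longrightarrow> 0 \<le> v \<Longrightarrow>
      (\<integral>\<^sup>+\<omega>. h (sinr_ratio (SNR (CUE i) BS \<omega>) (SNR (CUE i) Eve \<omega>) u v) \<partial>M) = ennreal (T u v)"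
  shows "(\<integral>\<^sup>+\<omega>. (if underlay_pairs m alloc i \<omega> = D \<and> (overlay_pairs m alloc \<omega> = {}) = c
      then h (sinr_ratio (SNR (CUE i) BS \<omega>) (SNR (CUE i) Eve \<omega>)
         (interference SNR D BS \<omega>) (interference SNR D Eve \<omega>)) else 0) \<partial>M) =
    ennreal (prob {\<omega> \<in> space M. underlay_pairs m alloc i \<omega> = D \<and> (overlay_pairs m alloc \<omega> = {}) = c} *
      expectation (\<lambda>\<omega>. T (interference SNR D BS \<omega>) (interference SNR D Eve \<omega>)))"
proof -
  note [measurable] = h T
  let ?X = "SNR (CUE i) BS" and ?Y = "SNR (CUE i) Eve" and ?U = "interference SNR D BS" and ?V = "interference SNR D Eve"
  have [measurable]: "random_variable borel ?X" "random_variable borel ?Y" "random_variable borel ?U" "random_variable borel ?V"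
    using i D by (auto intro!: SNR_measurable CUE_links interference_measurable)
  let ?W = "\<lambda>\<omega>. underlay_pairs m alloc i \<omega> = D \<and> (overlay_pairs m alloc \<omega> = {}) = c"
  let ?E = "{\<omega> \<in> space M. ?W \<omega>}"
  note [measurable] = allocation_event_measurable[of i D c]
  let ?r = "\<lambda>q. h (sinr_ratio (fst (fst q)) (snd (fst q)) (fst (snd q)) (snd (snd q)))"
  let ?Q = "\<lambda>\<omega>. ((?X \<omega>, ?Y \<omega>), (?U \<omega>, ?V \<omega>))"
  have r[measurable]: "?r \<in> borel_measurable ((borel \<Otimes>\<^sub>M borel) \<Otimes>\<^sub>M (borel \<Otimes>\<^sub>M borel))"
    unfolding sinr_ratio_def by measurable
  have int: "integrable M (\<lambda>\<omega>. T (?U \<omega>) (?V \<omega>))"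
  proof (rule integrable_const_bound[where B=B])
    show "AE \<omega> in M. norm (T (?U \<omega>) (?V \<omega>)) \<le> B"
      using interference_nonneg[OF D, of BS, simplified] interference_nonneg[OF D, of Eve, simplified]
      by eventually_elim (simp add: bound)
  qed measurable
  have nonneg: "AE \<omega> in M. 0 \<le> T (?U \<omega>) (?V \<omega>)"
    using interference_nonneg[OF D, of BS, simplified] interference_nonneg[OF D, of Eve, simplified]
    by eventually_elim (simp add: bound)
  have "(\<integral>\<^sup>+\<omega>. (if ?W \<omega> then ?r (?Q \<omega>) else 0) \<partial>M) = (\<integral>\<^sup>+\<omega>. (\<lambda>(w, q). if w then ?r q else 0) (?W \<omega>, ?Q \<omega>) \<partial>M)"
    by simp
  also have "\<dots> = (\<integral>\<^sup>+\<omega>. (\<integral>\<^sup>+\<omega>'. (\<lambda>(w, q). if w then ?r q else 0) (?W \<omega>', ?Q \<omega>) \<partial>M) \<partial>M)"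
    by (rule nn_integral_allocation_signals[OF D i]) measurable
  also have "\<dots> = (\<integral>\<^sup>+\<omega>. emeasure M ?E * ?r (?Q \<omega>) \<partial>M)"
  proof (intro nn_integral_cong)
    fix \<omega>
    have "(\<integral>\<^sup>+\<omega>'. (\<lambda>(w, q). if w then ?r q else 0) (?W \<omega>', ?Q \<omega>) \<partial>M) = (\<integral>\<^sup>+\<omega>'. ?r (?Q \<omega>) * indicator ?E \<omega>' \<partial>M)"
      by (intro nn_integral_cong) (simp add: indicator_def)
    also have "\<dots> = ?r (?Q \<omega>) * emeasure M ?E"
      by (rule nn_integral_cmult_indicator) measurable
    finally show "(\<integral>\<^sup>+\<omega>'. (\<lambda>(w, q). if w then ?r q else 0) (?W \<omega>', ?Q \<omega>) \<partial>M) = emeasure M ?E * ?r (?Q \<omega>)"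
      by (simp add: mult.commute)
  qed
  also have "\<dots> = emeasure M ?E * (\<integral>\<^sup>+\<omega>. ?r (?Q \<omega>) \<partial>M)"
    by (rule nn_integral_cmult) measurable
  also have "(\<integral>\<^sup>+\<omega>. ?r (?Q \<omega>) \<partial>M) = (\<integral>\<^sup>+\<omega>. (\<integral>\<^sup>+\<omega>'. ?r ((?X \<omega>', ?Y \<omega>'), (?U \<omega>, ?V \<omega>)) \<partial>M) \<partial>M)"
    by (rule indep_var_nn_integral[OF indep_signals_interferences[OF D i] r])
  also have "\<dots> = (\<integral>\<^sup>+\<omega>. ennreal (T (?U \<omega>) (?V \<omega>)) \<partial>M)"
  proof (rule nn_integral_cong_AE)
    show "AE \<omega> in M. (\<integral>\<^sup>+\<omega>'. ?r ((?X \<omega>', ?Y \<omega>'), (?U \<omega>, ?V \<omega>)) \<partial>M) = ennreal (T (?U \<omega>) (?V \<omega>))"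
      using interference_nonneg[OF D, of BS, simplified] interference_nonneg[OF D, of Eve, simplified]
      by eventually_elim (simp add: eq)
  qed
  also have "\<dots> = ennreal (expectation (\<lambda>\<omega>. T (?U \<omega>) (?V \<omega>)))"
    by (rule nn_integral_eq_integral[OF int nonneg])
  also have "emeasure M ?E * ennreal (expectation (\<lambda>\<omega>. T (?U \<omega>) (?V \<omega>))) = ennreal (prob ?E * expectation (\<lambda>\<omega>. T (?U \<omega>) (?V \<omega>)))"
    by (simp add: emeasure_eq_measure ennreal_mult integral_nonneg_AE[OF nonneg])
  finally show ?thesis by (simp only: fst_conv snd_conv)
qed

text \<open>An empty \<open>D\<close> needs its own case: the interferences are then constantly 0
  and have no density, and the kernel at the origin is the closed form.\<close>

lemma expectation_kernel_interference:
  assumes D: "D \<subseteq> {1..m}"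
    and T: "case_prod T \<in> borel_measurable (borel \<Otimes>\<^sub>M borel)"
    and bound: "\<And>u v. 0 \<le> u \<Longrightarrow> 0 \<le> v \<Longrightarrow> 0 \<le> T u v \<and> T u v \<le> B"
  shows "expectation (\<lambda>\<omega>. T (interference SNR D BS \<omega>) (interference SNR D Eve \<omega>)) =
    (if D = {} then T 0 0 else LBINT y:{0..}. (LBINT x:{0..}.
       T x y * prob_density M (interference SNR D BS) x * prob_density M (interference SNR D Eve) y))"
proof (cases "D = {}")
  case True
  then show ?thesis by (simp add: interference_def prob_space)
next
  case False
  have "(LBINT y:{0..}. (LBINT x:{0..}.
       T x y * prob_density M (interference SNR D BS) x * prob_density M (interference SNR D Eve) y))
     = expectation (\<lambda>\<omega>. T (interference SNR D BS \<omega>) (interference SNR D Eve \<omega>))"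
    by (rule expectation_kernel_densities[where B = B, OF interference_distributed[OF D False] _
          interference_distributed[OF D False] _ indep_interferences[OF D]
          interference_nonneg[OF D] interference_nonneg[OF D] T])
       (use bound in \<open>auto simp: prob_density_def\<close>)
  with False show ?thesis by simp
qed

lemma expectation_secrecy_tail:
  assumes D: "D \<subseteq> {1..m}" and i: "i \<in> {1..n}" and "0 < r\<^sub>s" "0 < \<beta>"
  shows "expectation (\<lambda>\<omega>. secrecy_tail (\<gamma> (CUE i) BS) (\<gamma> (CUE i) Eve) (2 powr (real n * r\<^sub>s / \<beta>))
      (interference SNR D BS \<omega>) (interference SNR D Eve \<omega>)) = Theta M n \<gamma> SNR r\<^sub>s i D \<beta>"
proof -
  have K: "1 \<le> (2::real) powr (real n * r\<^sub>s / \<beta>)"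
    using assms by (intro ge_one_powr_ge_zero) auto
  show ?thesis
    using assms secrecy_tail_bounds[OF mean_pos[OF CUE_links(1)[OF i]] mean_pos[OF CUE_links(2)[OF i]] K]
    by (subst expectation_kernel_interference[where B = 1])
       (auto simp: Theta_def Let_def secrecy_tail_def)
qed

lemma expectation_secrecy_mean:
  assumes D: "D \<subseteq> {1..m}" and i: "i \<in> {1..n}"
  shows "expectation (\<lambda>\<omega>. secrecy_mean (\<gamma> (CUE i) BS) (\<gamma> (CUE i) Eve)
      (interference SNR D BS \<omega>) (interference SNR D Eve \<omega>)) = Lambda M \<gamma> SNR i D"
  using assms secrecy_mean_bounds[OF mean_pos[OF CUE_links(1)[OF i]] mean_pos[OF CUE_links(2)[OF i]]]
  by (subst expectation_kernel_interference[where B = "\<gamma> (CUE i) BS"])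
     (auto simp: Lambda_def Let_def secrecy_mean_def)

section \<open>Outage probability and average secrecy capacity\<close>

lemma secrecy_capacity_alt:
  "secrecy_capacity n m \<beta> SNR alloc i \<omega> = (if overlay_pairs m alloc \<omega> = {} then 1 else \<beta>) / real n *
    max (log 2 (sinr_ratio (SNR (CUE i) BS \<omega>) (SNR (CUE i) Eve \<omega>)
      (interference SNR (underlay_pairs m alloc i \<omega>) BS \<omega>)
      (interference SNR (underlay_pairs m alloc i \<omega>) Eve \<omega>))) 0"
  by (simp add: secrecy_capacity_def cellular_fraction_def SINR_def sinr_ratio_def)

text \<open>The interference is summed over a random set. This set takes finitely many values, so it
  suffices to treat each fixed \<open>D\<close> and to compose.\<close>

lemma secrecy_capacity_measurable:
  assumes i: "i \<in> {1..n}"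
  shows "random_variable borel (secrecy_capacity n m \<beta> SNR alloc i)"
proof -
  note [measurable] = alloc_pred_measurable
  have "Measurable.pred M (\<lambda>\<omega>. \<forall>j\<in>{1..m}. \<not> alloc j \<omega> = None)"
    by measurable
  then have [measurable]: "Measurable.pred M (\<lambda>\<omega>. overlay_pairs m alloc \<omega> = {})"
    by (simp add: overlay_pairs_def)
  have U: "underlay_pairs m alloc i \<in> measurable M (count_space (Pow {1..m}))"
    unfolding measurable_count_space_eq2[OF finite_Pow_iff[THEN iffD2, OF finite_atLeastAtMost]]
  proof (intro conjI ballI)
    fix D assume D: "D \<in> Pow {1..m}"
    have "underlay_pairs m alloc i \<omega> = D \<longleftrightarrow> (\<forall>j\<in>{1..m}. (alloc j \<omega> = Some i) = (j \<in> D))" for \<omega>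
      using D unfolding underlay_pairs_def set_eq_iff by blast
    then have "underlay_pairs m alloc i -` {D} \<inter> space M =
        {\<omega> \<in> space M. \<forall>j\<in>{1..m}. (alloc j \<omega> = Some i) = (j \<in> D)}"
      by (simp add: vimage_def Int_def conj_commute)
    also have "\<dots> \<in> events" by measurable
    finally show "underlay_pairs m alloc i -` {D} \<inter> space M \<in> events" .
  qed (auto simp: underlay_pairs_def)
  have "(\<lambda>\<omega>. (\<lambda>D \<omega>. (if overlay_pairs m alloc \<omega> = {} then 1 else \<beta>) / real n *
    max (log 2 (sinr_ratio (SNR (CUE i) BS \<omega>) (SNR (CUE i) Eve \<omega>)
      (interference SNR D BS \<omega>) (interference SNR D Eve \<omega>))) 0) (underlay_pairs m alloc i \<omega>) \<omega>) \<in> borel_measurable M"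
  proof (rule measurable_compose_countable'[OF _ U])
    fix D assume "D \<in> Pow {1..m}"
    then have [measurable]: "random_variable borel (SNR (CUE i) BS)" "random_variable borel (SNR (CUE i) Eve)"
      "random_variable borel (interference SNR D BS)" "random_variable borel (interference SNR D Eve)"
      using i by (auto intro!: SNR_measurable CUE_links interference_measurable)
    show "(\<lambda>\<omega>. (if overlay_pairs m alloc \<omega> = {} then 1 else \<beta>) / real n *
      max (log 2 (sinr_ratio (SNR (CUE i) BS \<omega>) (SNR (CUE i) Eve \<omega>)
        (interference SNR D BS \<omega>) (interference SNR D Eve \<omega>))) 0) \<in> borel_measurable M"
      unfolding sinr_ratio_def by measurable
  qed (simp add: countable_finite)
  then show ?thesis by (simp add: secrecy_capacity_alt[abs_def])
qed

text \<open>The exceptional null set must not depend on the random set of pairs, so the null sets of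
  all subsets of \<open>{1..m}\<close> are united first.\<close>

lemma AE_signals_nonneg:
  assumes i: "i \<in> {1..n}"
  shows "AE \<omega> in M. 0 \<le> SNR (CUE i) BS \<omega> \<and> 0 \<le> SNR (CUE i) Eve \<omega> \<and>
    0 \<le> interference SNR (underlay_pairs m alloc i \<omega>) BS \<omega> \<and>
    0 \<le> interference SNR (underlay_pairs m alloc i \<omega>) Eve \<omega>"
proof -
  have U: "underlay_pairs m alloc i \<omega> \<in> Pow {1..m}" for \<omega>
    by (auto simp: underlay_pairs_def)
  have interference: "AE \<omega> in M. \<forall>D\<in>Pow {1..m}. 0 \<le> interference SNR D b \<omega>" if "b \<in> {BS, Eve}" for b
    by (intro AE_finite_allI interference_nonneg that) simp_all
  show ?thesis
    using SNR_nonneg[OF CUE_links(1)[OF i]] SNR_nonneg[OF CUE_links(2)[OF i]]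
      interference[of BS, simplified] interference[of Eve, simplified]
    by eventually_elim (use U in auto)
qed

text \<open>Common skeleton of both formulas, a partition of the sample space by \<open>D\<close>
  and \<open>c\<close>, where \<open>c\<close> says that no pair is in overlay mode and so selects
  the bandwidth fraction. Nonnegative integrals are used up to the end, so integrability of
  \<open>Z\<close> comes out together with its mean.\<close>

lemma expectation_allocation_partition:
  assumes i: "i \<in> {1..n}"
    and Z: "Z \<in> borel_measurable M" "\<And>\<omega>. 0 \<le> Z \<omega>"
    and h: "\<And>c. h c \<in> borel_measurable borel"
    and T: "\<And>c. case_prod (T c) \<in> borel_measurable (borel \<Otimes>\<^sub>M borel)"
    and bound: "\<And>c u v. 0 \<le> u \<Longrightarrow> 0 \<le> v \<Longrightarrow> 0 \<le> T c u v \<and> T c u v \<le> B c"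
    and eq: "\<And>c u v. 0 \<le> u \<Longrightarrow> 0 \<le> v \<Longrightarrow>
      (\<integral>\<^sup>+\<omega>. h c (sinr_ratio (SNR (CUE i) BS \<omega>) (SNR (CUE i) Eve \<omega>) u v) \<partial>M) = ennreal (T c u v)"
    and Zh: "AE \<omega> in M. ennreal (Z \<omega>) = h (overlay_pairs m alloc \<omega> = {})
      (sinr_ratio (SNR (CUE i) BS \<omega>) (SNR (CUE i) Eve \<omega>)
        (interference SNR (underlay_pairs m alloc i \<omega>) BS \<omega>)
        (interference SNR (underlay_pairs m alloc i \<omega>) Eve \<omega>))"
  shows "integrable M Z \<and> expectation Z = (\<Sum>D\<in>Pow {1..m}. \<Sum>c\<in>UNIV.
      prob {\<omega> \<in> space M. underlay_pairs m alloc i \<omega> = D \<and> (overlay_pairs m alloc \<omega> = {}) = c} *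
      expectation (\<lambda>\<omega>. T c (interference SNR D BS \<omega>) (interference SNR D Eve \<omega>)))"
proof -
  let ?r = "\<lambda>D \<omega>. sinr_ratio (SNR (CUE i) BS \<omega>) (SNR (CUE i) Eve \<omega>) (interference SNR D BS \<omega>) (interference SNR D Eve \<omega>)"
  let ?W = "\<lambda>D c \<omega>. underlay_pairs m alloc i \<omega> = D \<and> (overlay_pairs m alloc \<omega> = {}) = c"
  let ?s = "\<lambda>D c. prob {\<omega> \<in> space M. ?W D c \<omega>} * expectation (\<lambda>\<omega>. T c (interference SNR D BS \<omega>) (interference SNR D Eve \<omega>))"
  have meas: "(\<lambda>\<omega>. if ?W D c \<omega> then h c (?r D \<omega>) else 0) \<in> borel_measurable M" if "D \<in> Pow {1..m}" for D c
  proof -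
    note [measurable] = h allocation_event_measurable
    have [measurable]: "random_variable borel (SNR (CUE i) BS)" "random_variable borel (SNR (CUE i) Eve)"
      "random_variable borel (interference SNR D BS)" "random_variable borel (interference SNR D Eve)"
      using i that by (auto intro!: SNR_measurable CUE_links interference_measurable)
    show ?thesis unfolding sinr_ratio_def by measurable
  qed
  have nonneg: "0 \<le> ?s D c" if "D \<in> Pow {1..m}" for D c
  proof -
    have "AE \<omega> in M. 0 \<le> T c (interference SNR D BS \<omega>) (interference SNR D Eve \<omega>)"
      using interference_nonneg[OF PowD[OF that], of BS, simplified] interference_nonneg[OF PowD[OF that], of Eve, simplified]
      by eventually_elim (simp add: bound)
    then show ?thesis by (intro mult_nonneg_nonneg integral_nonneg_AE) auto
  qed
  \<comment> \<open>Exactly one pair of \<open>D\<close> and \<open>c\<close> describes the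
    allocation at \<open>\<omega>\<close>, so the double sum has a single active term.\<close>
  have split: "h (overlay_pairs m alloc \<omega> = {}) (?r (underlay_pairs m alloc i \<omega>) \<omega>) =
    (\<Sum>D\<in>Pow {1..m}. \<Sum>c\<in>UNIV. if ?W D c \<omega> then h c (?r D \<omega>) else 0)" for \<omega>
  proof -
    have "(\<Sum>D\<in>Pow {1..m}. \<Sum>c\<in>UNIV. if ?W D c \<omega> then h c (?r D \<omega>) else 0) =
      (\<Sum>D\<in>Pow {1..m}. if underlay_pairs m alloc i \<omega> = D then h (overlay_pairs m alloc \<omega> = {}) (?r D \<omega>) else 0)"
      by (intro sum.cong) (auto simp: UNIV_bool)
    also have "\<dots> = h (overlay_pairs m alloc \<omega> = {}) (?r (underlay_pairs m alloc i \<omega>) \<omega>)"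
      by (subst sum.delta') (auto simp: underlay_pairs_def)
    finally show ?thesis by simp
  qed
  have "(\<integral>\<^sup>+\<omega>. ennreal (Z \<omega>) \<partial>M) = (\<integral>\<^sup>+\<omega>. (\<Sum>D\<in>Pow {1..m}. \<Sum>c\<in>UNIV. if ?W D c \<omega> then h c (?r D \<omega>) else 0) \<partial>M)"
    using Zh by (intro nn_integral_cong_AE) (simp only: split)
  also have "\<dots> = (\<Sum>D\<in>Pow {1..m}. \<integral>\<^sup>+\<omega>. (\<Sum>c\<in>UNIV. if ?W D c \<omega> then h c (?r D \<omega>) else 0) \<partial>M)"
    using meas by (intro nn_integral_sum borel_measurable_sum)
  also have "\<dots> = (\<Sum>D\<in>Pow {1..m}. \<Sum>c\<in>UNIV. \<integral>\<^sup>+\<omega>. (if ?W D c \<omega> then h c (?r D \<omega>) else 0) \<partial>M)"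
    using meas by (intro sum.cong refl nn_integral_sum)
  also have "\<dots> = (\<Sum>D\<in>Pow {1..m}. \<Sum>c\<in>UNIV. ennreal (?s D c))"
    by (intro sum.cong refl nn_integral_allocation_ratio[OF _ i h T bound eq]) auto
  also have "\<dots> = ennreal (\<Sum>D\<in>Pow {1..m}. \<Sum>c\<in>UNIV. ?s D c)"
  proof -
    have "(\<Sum>D\<in>Pow {1..m}. \<Sum>c\<in>UNIV. ennreal (?s D c)) = (\<Sum>D\<in>Pow {1..m}. ennreal (\<Sum>c\<in>UNIV. ?s D c))"
      by (intro sum.cong refl sum_ennreal nonneg)
    also have "\<dots> = ennreal (\<Sum>D\<in>Pow {1..m}. \<Sum>c\<in>UNIV. ?s D c)"
      by (intro sum_ennreal sum_nonneg nonneg)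
    finally show ?thesis .
  qed
  finally have "(\<integral>\<^sup>+\<omega>. ennreal (Z \<omega>) \<partial>M) = ennreal (\<Sum>D\<in>Pow {1..m}. \<Sum>c\<in>UNIV. ?s D c)" .
  then show ?thesis
    using Z nonneg by (subst (asm) nn_integral_eq_integrable) (auto intro!: sum_nonneg)
qed

lemma prob_secrecy_capacity_ge:
  assumes i: "i \<in> {1..n}" and "0 \<le> \<beta>" "0 < r\<^sub>s"
  shows "prob {\<omega> \<in> space M. r\<^sub>s \<le> secrecy_capacity n m \<beta> SNR alloc i \<omega>} = (\<Sum>D\<in>Pow {1..m}. \<Sum>c\<in>UNIV.
      prob {\<omega> \<in> space M. underlay_pairs m alloc i \<omega> = D \<and> (overlay_pairs m alloc \<omega> = {}) = c} *
      Theta M n \<gamma> SNR r\<^sub>s i D (if c then 1 else \<beta>))"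
proof -
  let ?G = "{\<omega> \<in> space M. r\<^sub>s \<le> secrecy_capacity n m \<beta> SNR alloc i \<omega>}"
  let ?b = "\<lambda>c. if c then 1 else \<beta>"
  let ?\<gamma>B = "\<gamma> (CUE i) BS" and ?\<gamma>E = "\<gamma> (CUE i) Eve"
  note links = CUE_links[OF i]
  have n: "0 < real n" using i by auto
  \<comment> \<open>If \<open>?b c = 0\<close>, the quotient is 0 by convention and
    \<open>K c = 1\<close>, so \<open>1 \<le> K c\<close> holds in all cases. The capacity is then 0
    and below \<open>r\<^sub>s\<close>, which is why \<open>h\<close> and \<open>T\<close> are set
    to 0 there, in agreement with \<open>Theta\<close>.\<close>
  define K where "K = (\<lambda>c. (2::real) powr (real n * r\<^sub>s / ?b c))"
  define h where "h = (\<lambda>c R. if ?b c = 0 then 0 else indicator {K c..} R :: ennreal)"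
  define T where "T = (\<lambda>c u v. if ?b c = 0 then 0 else secrecy_tail ?\<gamma>B ?\<gamma>E (K c) u v)"
  have K: "1 \<le> K c" for c
    unfolding K_def using assms n by (intro ge_one_powr_ge_zero) auto
  have G: "?G \<in> events"
    using secrecy_capacity_measurable[OF i, of \<beta>] by measurable
  have le_scale_iff: "r\<^sub>s \<le> b / k * x \<longleftrightarrow> k * r\<^sub>s / b \<le> x" if "0 < b" "0 < k" for b k x :: real
    using that by (simp add: field_simps)
  have iff: "r\<^sub>s \<le> ?b c / real n * max (log 2 R) 0 \<longleftrightarrow> ?b c \<noteq> 0 \<and> K c \<le> R" if R: "0 < R" for c R
  proof (cases "?b c = 0")
    case False
    then have b: "0 < ?b c" using assms by (auto split: if_splits)
    \<comment> \<open>The threshold is positive, so the maximum with 0 cannot reach it through its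
      second argument.\<close>
    then have "0 < real n * r\<^sub>s / ?b c" using n assms by simp
    moreover have "r\<^sub>s \<le> ?b c / real n * max (log 2 R) 0 \<longleftrightarrow> real n * r\<^sub>s / ?b c \<le> max (log 2 R) 0"
      by (rule le_scale_iff[OF b n])
    moreover have "real n * r\<^sub>s / ?b c \<le> log 2 R \<longleftrightarrow> K c \<le> R"
      unfolding K_def using R by (subst le_log_iff) auto
    ultimately show ?thesis using False by (simp add: le_max_iff_disj)
  qed (use assms in auto)
  have "integrable M (indicat_real ?G) \<and> expectation (indicat_real ?G) = (\<Sum>D\<in>Pow {1..m}. \<Sum>c\<in>UNIV.
      prob {\<omega> \<in> space M. underlay_pairs m alloc i \<omega> = D \<and> (overlay_pairs m alloc \<omega> = {}) = c} *
      expectation (\<lambda>\<omega>. T c (interference SNR D BS \<omega>) (interference SNR D Eve \<omega>)))"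
  proof (rule expectation_allocation_partition[where h = h and B = "\<lambda>_. 1", OF i])
    show "indicat_real ?G \<in> borel_measurable M" using G by measurable
    show "h c \<in> borel_measurable borel" for c unfolding h_def by measurable
    show "case_prod (T c) \<in> borel_measurable (borel \<Otimes>\<^sub>M borel)" for c
      by (cases "?b c = 0") (simp_all add: T_def borel_measurable_secrecy_tail)
    fix c :: bool and u v :: real assume uv: "0 \<le> u" "0 \<le> v"
    show "0 \<le> T c u v \<and> T c u v \<le> 1"
      using secrecy_tail_bounds[OF mean_pos[OF links(1)] mean_pos[OF links(2)] K uv] by (simp add: T_def)
    show "(\<integral>\<^sup>+\<omega>. h c (sinr_ratio (SNR (CUE i) BS \<omega>) (SNR (CUE i) Eve \<omega>) u v) \<partial>M) = ennreal (T c u v)"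
      using nn_integral_secrecy_tail[OF SNR_exponential[OF links(1)] SNR_exponential[OF links(2)]
          indep_signals[OF i] mean_pos[OF links(1)] mean_pos[OF links(2)] K uv]
      by (simp add: h_def T_def)
  next
    show "AE \<omega> in M. ennreal (indicat_real ?G \<omega>) = h (overlay_pairs m alloc \<omega> = {})
      (sinr_ratio (SNR (CUE i) BS \<omega>) (SNR (CUE i) Eve \<omega>)
        (interference SNR (underlay_pairs m alloc i \<omega>) BS \<omega>)
        (interference SNR (underlay_pairs m alloc i \<omega>) Eve \<omega>))"
      using AE_signals_nonneg[OF i] AE_space
    proof eventually_elim
      case (elim \<omega>)
      then have "\<omega> \<in> ?G \<longleftrightarrow> ?b (overlay_pairs m alloc \<omega> = {}) \<noteq> 0 \<and> K (overlay_pairs m alloc \<omega> = {}) \<le>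
        sinr_ratio (SNR (CUE i) BS \<omega>) (SNR (CUE i) Eve \<omega>)
        (interference SNR (underlay_pairs m alloc i \<omega>) BS \<omega>)
        (interference SNR (underlay_pairs m alloc i \<omega>) Eve \<omega>)"
        by (subst iff[symmetric]) (auto intro!: sinr_ratio_pos simp: secrecy_capacity_alt)
      then show ?case unfolding h_def by (auto simp: indicator_def)
    qed
  qed simp
  moreover have T: "expectation (\<lambda>\<omega>. T c (interference SNR D BS \<omega>) (interference SNR D Eve \<omega>)) =
      Theta M n \<gamma> SNR r\<^sub>s i D (?b c)" if "D \<in> Pow {1..m}" for D c
    using expectation_secrecy_tail[of D i r\<^sub>s "?b c"] that i assms
    by (cases "?b c = 0") (auto simp: T_def K_def Theta_def)
  moreover have "expectation (indicat_real ?G) = prob ?G"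
    using G by simp
  ultimately show ?thesis by (simp only: T cong: sum.cong)
qed

lemma expectation_secrecy_capacity:
  assumes i: "i \<in> {1..n}" and "0 \<le> \<beta>"
  shows "integrable M (secrecy_capacity n m \<beta> SNR alloc i) \<and>
    expectation (secrecy_capacity n m \<beta> SNR alloc i) = (\<Sum>D\<in>Pow {1..m}. \<Sum>c\<in>UNIV.
      prob {\<omega> \<in> space M. underlay_pairs m alloc i \<omega> = D \<and> (overlay_pairs m alloc \<omega> = {}) = c} *
      ((if c then 1 else \<beta>) / (real n * ln 2) * Lambda M \<gamma> SNR i D))"
proof -
  \<comment> \<open>The factor \<open>1 / ln 2\<close> converts the mean of the natural logarithm to
    base 2.\<close>
  let ?b = "\<lambda>c. (if c then 1 else \<beta>) / (real n * ln 2)"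
  let ?\<gamma>B = "\<gamma> (CUE i) BS" and ?\<gamma>E = "\<gamma> (CUE i) Eve"
  note links = CUE_links[OF i]
  have b: "0 \<le> ?b c" for c using assms by auto
  define h where "h = (\<lambda>c R. ennreal (?b c) * ennreal (max (ln R) 0))"
  define T where "T = (\<lambda>c u v. ?b c * secrecy_mean ?\<gamma>B ?\<gamma>E u v)"
  have "integrable M (secrecy_capacity n m \<beta> SNR alloc i) \<and>
    expectation (secrecy_capacity n m \<beta> SNR alloc i) = (\<Sum>D\<in>Pow {1..m}. \<Sum>c\<in>UNIV.
      prob {\<omega> \<in> space M. underlay_pairs m alloc i \<omega> = D \<and> (overlay_pairs m alloc \<omega> = {}) = c} *
      expectation (\<lambda>\<omega>. T c (interference SNR D BS \<omega>) (interference SNR D Eve \<omega>)))"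
  proof (rule expectation_allocation_partition[where h = h and B = "\<lambda>c. ?b c * ?\<gamma>B", OF i])
    show "random_variable borel (secrecy_capacity n m \<beta> SNR alloc i)"
      by (rule secrecy_capacity_measurable[OF i])
    show "0 \<le> secrecy_capacity n m \<beta> SNR alloc i \<omega>" for \<omega>
      using assms by (simp add: secrecy_capacity_alt)
    show "h c \<in> borel_measurable borel" for c unfolding h_def by measurable
    show "case_prod (T c) \<in> borel_measurable (borel \<Otimes>\<^sub>M borel)" for c
      unfolding T_def by measurable
    fix c :: bool and u v :: real assume uv: "0 \<le> u" "0 \<le> v"
    note mean = secrecy_mean_bounds[OF mean_pos[OF links(1)] mean_pos[OF links(2)] uv]
    show "0 \<le> T c u v \<and> T c u v \<le> ?b c * ?\<gamma>B"
      unfolding T_def using b mean by (intro conjI mult_nonneg_nonneg mult_left_mono)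
    have [measurable]: "random_variable borel (SNR (CUE i) BS)" "random_variable borel (SNR (CUE i) Eve)"
      using links by (auto intro!: SNR_measurable)
    have "(\<integral>\<^sup>+\<omega>. h c (sinr_ratio (SNR (CUE i) BS \<omega>) (SNR (CUE i) Eve \<omega>) u v) \<partial>M) =
      ennreal (?b c) * (\<integral>\<^sup>+\<omega>. ennreal (max (ln (sinr_ratio (SNR (CUE i) BS \<omega>) (SNR (CUE i) Eve \<omega>) u v)) 0) \<partial>M)"
      unfolding h_def sinr_ratio_def by (rule nn_integral_cmult) measurable
    also have "\<dots> = ennreal (?b c) * ennreal (secrecy_mean ?\<gamma>B ?\<gamma>E u v)"
      by (simp only: nn_integral_secrecy_mean[OF SNR_exponential[OF links(1)] SNR_exponential[OF links(2)]
          indep_signals[OF i] mean_pos[OF links(1)] mean_pos[OF links(2)] uv])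
    also have "\<dots> = ennreal (T c u v)"
      unfolding T_def using b mean by (simp only: ennreal_mult)
    finally show "(\<integral>\<^sup>+\<omega>. h c (sinr_ratio (SNR (CUE i) BS \<omega>) (SNR (CUE i) Eve \<omega>) u v) \<partial>M) = ennreal (T c u v)" .
  next
    have max: "max (log 2 R) 0 = max (ln R) 0 / ln 2" for R :: real
      by (simp add: log_def max_def divide_le_0_iff)
    show "AE \<omega> in M. ennreal (secrecy_capacity n m \<beta> SNR alloc i \<omega>) = h (overlay_pairs m alloc \<omega> = {})
      (sinr_ratio (SNR (CUE i) BS \<omega>) (SNR (CUE i) Eve \<omega>)
        (interference SNR (underlay_pairs m alloc i \<omega>) BS \<omega>)
        (interference SNR (underlay_pairs m alloc i \<omega>) Eve \<omega>))"
      unfolding secrecy_capacity_alt h_def max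
      by (subst ennreal_mult[symmetric]) (use b in \<open>auto simp: mult_ac\<close>)
  qed
  moreover have T: "expectation (\<lambda>\<omega>. T c (interference SNR D BS \<omega>) (interference SNR D Eve \<omega>)) =
      ?b c * Lambda M \<gamma> SNR i D" if "D \<in> Pow {1..m}" for D c
    using expectation_secrecy_mean[of D i] that i by (simp add: T_def)
  ultimately show ?thesis by (simp only: T cong: sum.cong)
qed

end

theorem theorem1:
  fixes M :: "'a measure"
    and n m i :: nat
    and p \<beta> r\<^sub>s \<epsilon> \<theta> :: real
    and \<gamma> :: "transmitter \<Rightarrow> receiver \<Rightarrow> real"
    and SNR :: "transmitter \<Rightarrow> receiver \<Rightarrow> 'a \<Rightarrow> real"
    and alloc :: "nat \<Rightarrow> 'a \<Rightarrow> nat option"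
  assumes "n \<ge> 1" and "m \<ge> 1"
    and "p \<in> {0..1}" and "\<beta> \<in> {0..1}" and "r\<^sub>s > 0"
    and "d2d_network M n m p \<gamma> SNR alloc"
    and "i \<in> {1..n}"
    and "\<epsilon> = p / real n" and "\<theta> = p * (1 - 1 / real n)"
  shows "measure M {\<omega> \<in> space M. secrecy_capacity n m \<beta> SNR alloc i \<omega> < r\<^sub>s} =
           1 - (\<Sum>D\<in>Pow {1..m}. \<epsilon> ^ card D *
                  (\<theta> ^ (m - card D) * Theta M n \<gamma> SNR r\<^sub>s i D 1 +
                   ((1 - \<epsilon>) ^ (m - card D) - \<theta> ^ (m - card D)) * Theta M n \<gamma> SNR r\<^sub>s i D \<beta>)) \<and>
         integrable M (secrecy_capacity n m \<beta> SNR alloc i) \<and>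
         integral\<^sup>L M (secrecy_capacity n m \<beta> SNR alloc i) =
           1 / (real n * ln 2) *
           (\<Sum>D\<in>Pow {1..m}. \<epsilon> ^ card D * Lambda M \<gamma> SNR i D *
              (\<beta> * (1 - \<epsilon>) ^ (m - card D) + (1 - \<beta>) * \<theta> ^ (m - card D)))"
proof -
  interpret d2d_network M n m p \<gamma> SNR alloc by fact
  let ?C = "secrecy_capacity n m \<beta> SNR alloc i"
  let ?P = "\<lambda>D c. prob {\<omega> \<in> space M. underlay_pairs m alloc i \<omega> = D \<and> (overlay_pairs m alloc \<omega> = {}) = c}"
  have \<beta>: "0 \<le> \<beta>" using assms by simp
  have P: "?P D c = \<epsilon> ^ card D * (if c then \<theta> ^ (m - card D) else (1 - \<epsilon>) ^ (m - card D) - \<theta> ^ (m - card D))"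
    if "D \<in> Pow {1..m}" for D c
    by (rule prob_allocation_event) (use assms that in auto)
  note [measurable] = secrecy_capacity_measurable[OF \<open>i \<in> {1..n}\<close>, of \<beta>]
  have "{\<omega> \<in> space M. r\<^sub>s \<le> ?C \<omega>} \<in> events" by measurable
  \<comment> \<open>Outage is the complement of the event that the partition formula
    evaluates.\<close>
  moreover have "{\<omega> \<in> space M. ?C \<omega> < r\<^sub>s} = space M - {\<omega> \<in> space M. r\<^sub>s \<le> ?C \<omega>}"
    by auto
  ultimately have "prob {\<omega> \<in> space M. ?C \<omega> < r\<^sub>s} = 1 - prob {\<omega> \<in> space M. r\<^sub>s \<le> ?C \<omega>}"
    by (simp only: prob_compl)
  also have "prob {\<omega> \<in> space M. r\<^sub>s \<le> ?C \<omega>} = (\<Sum>D\<in>Pow {1..m}. \<epsilon> ^ card D *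
                  (\<theta> ^ (m - card D) * Theta M n \<gamma> SNR r\<^sub>s i D 1 +
                   ((1 - \<epsilon>) ^ (m - card D) - \<theta> ^ (m - card D)) * Theta M n \<gamma> SNR r\<^sub>s i D \<beta>))"
    unfolding prob_secrecy_capacity_ge[OF \<open>i \<in> {1..n}\<close> \<beta> \<open>r\<^sub>s > 0\<close>]
    by (intro sum.cong refl) (simp only: P UNIV_bool, simp add: algebra_simps)
  finally have outage: "prob {\<omega> \<in> space M. ?C \<omega> < r\<^sub>s} = 1 - \<dots>" .
  have "expectation ?C = (\<Sum>D\<in>Pow {1..m}. \<Sum>c\<in>UNIV. ?P D c * ((if c then 1 else \<beta>) / (real n * ln 2) * Lambda M \<gamma> SNR i D))"
    using expectation_secrecy_capacity[OF \<open>i \<in> {1..n}\<close> \<beta>] by simp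
  \<comment> \<open>For each \<open>D\<close>, the term without overlay pairs has fraction 1 and the
    other has fraction \<open>\<beta>\<close>; collecting the powers of \<open>\<theta>\<close>
    leaves the coefficient \<open>1 - \<beta>\<close>.\<close>
  also have "\<dots> = 1 / (real n * ln 2) *
           (\<Sum>D\<in>Pow {1..m}. \<epsilon> ^ card D * Lambda M \<gamma> SNR i D *
              (\<beta> * (1 - \<epsilon>) ^ (m - card D) + (1 - \<beta>) * \<theta> ^ (m - card D)))"
    unfolding sum_distrib_left
    by (intro sum.cong refl) (simp only: P UNIV_bool, simp add: algebra_simps add_divide_distrib diff_divide_distrib)
  finally show ?thesis
    using outage expectation_secrecy_capacity[OF \<open>i \<in> {1..n}\<close> \<beta>] by simp
qed

end
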